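(* Let $(\mathcal V,\{l_{2n+1}\}_{n=0}^\infty)$ be a $3$-$Lie_\infty$-algebra. For $n\ge 1$ put $\mathfrak l_n:=\widetilde l_{2n-1}:\otimes^{n}(\wedge^2\mathcal V)\to\wedge^2\mathcal V$, where $\widetilde l_{2n+1}$ is the map induced by $l_{2n+1}$ via $$\widetilde l_{2n+1}(X_1,\dots,X_{n+1})=(-1)^{|x_{n+1}|(|X_1|+\dots+|X_n|+n-1)}\,x_{n+1}\wedge l_{2n+1}(X_1,\dots,X_n,y_{n+1})+l_{2n+1}(X_1,\dots,X_n,x_{n+1})\wedge y_{n+1}$$ for homogeneous $X_a=x_a\wedge y_a$. Then $(\wedge^2\mathcal V,\{\mathfrak l_n\}_{n=1}^\infty)$ is a $Lod_\infty$-algebra.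
   Context: Vector spaces are over a fixed field of characteristic $0$. Exterior powers of a graded vector space are taken in the graded sense, $x\wedge y=-(-1)^{|x||y|}y\wedge x$; for $X=x\wedge y\in\wedge^2\mathcal V$ with $x,y$ homogeneous, $|X|=|x|+|y|$. Signs and unshuffles: a $(p,q)$-unshuffle is a permutation $\sigma\in S_{p+q}$ with $\sigma(1)<\dots<\sigma(p)$ and $\sigma(p+1)<\dots<\sigma(p+q)$. $\mathrm{sgn}(\sigma)$ is the signature; $\mathrm{Ksgn}(\sigma)$ is the Koszul sign determined by the degrees only, i.e. the sign arising from $x_1\cdots x_m=\mathrm{Ksgn}(\sigma)\,x_{\sigma(1)}\cdots x_{\sigma(m)}$ in the free graded commutative algebra ($xy=(-1)^{|x||y|}yx$). $Lod_\infty$-algebra (strongly homotopy Leibniz algebra): a graded vector space $L=L_0\oplus L_1\oplus\cdots$ with linear maps $l_k:\otimes^kL\to L$ ($k\ge1$) of degree $k-2$ such that for every $n\ge 1$ and homogeneous $x_1,\dots,x_n\in L$, $$\sum_{\substack{i+j=n+1\\ i,j\ge1}}\ \sum_{j\le k\le n}\ \sum_{\sigma}(-1)^{(k+1-j)(j-1)}(-1)^{j(|x_{\sigma(1)}|+\cdots+|x_{\sigma(k-j)}|)}\mathrm{sgn}(\sigma)\mathrm{Ksgn}(\sigma)$$ $$\qquad l_i(x_{\sigma(1)},\dots,x_{\sigma(k-j)},l_j(x_{\sigma(k+1-j)},\dots,x_{\sigma(k-1)},x_k),x_{k+1},\dots,x_n)=0,$$ where $\sigma$ runs over $(k-j,j-1)$-unshuffles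 of $\{1,\dots,k-1\}$. $3$-$Lie_\infty$-algebra: a graded vector space $\mathcal V=V_0\oplus V_1\oplus\cdots$ with linear maps $l_{2n+1}:(\wedge^2\mathcal V)^{\otimes n}\wedge\mathcal V\to\mathcal V$ of degree $n-1$, $n=0,1,2,\dots$. Here the domain is $\mathcal V$ for $n=0$ and $(\wedge^2\mathcal V)^{\otimes(n-1)}\otimes\wedge^3\mathcal V$ for $n\ge1$; i.e. $l_{2n+1}(X_1,\dots,X_n,x)$ is graded skew-symmetric in the three entries of $X_n=x_n\wedge y_n$ and $x$. With $\widetilde l_{2n+1}$ as in the claim, one requires that for every $n\ge1$, all homogeneous $X_1,\dots,X_{n-1}\in\wedge^2\mathcal V$ and $x\in\mathcal V$, $$\sum_{\substack{i+j=n-1\\ i,j\ge0}}\ \sum_{j+1\le k\le n-1}\ \sum_{\sigma}(-1)^{(k-j)j}(-1)^{(j+1)(|X_{\sigma(1)}|+\cdots+|X_{\sigma(k-j-1)}|)}\mathrm{sgn}(\sigma)\mathrm{Ksgn}(\sigma)$$ $$\qquad l_{2i+1}(X_{\sigma(1)},\dots,X_{\sigma(k-j-1)},\widetilde l_{2j+1}(X_{\sigma(k-j)},\dots,X_{\sigma(k-1)},X_k),X_{k+1},\dots,X_{n-1},x)$$ $$+\sum_{\substack{i+j=n-1\\ i,j\ge0}}\ \sum_{\sigma}(-1)^{(i+1)j}(-1)^{(j+1)(|X_{\sigma(1)}|+\cdots+|X_{\sigma(i)}|)}\mathrm{sgn}(\sigma)\mathrm{Ksgn}(\sigma)$$ $$\qquad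 l_{2i+1}(X_{\sigma(1)},\dots,X_{\sigma(i)},l_{2j+1}(X_{\sigma(i+1)},\dots,X_{\sigma(n-1)},x))=0,$$ where in the first sum $\sigma$ runs over $(k-j-1,j)$-unshuffles of $\{1,\dots,k-1\}$ and in the second over $(i,j)$-unshuffles of $\{1,\dots,n-1\}$. *)

theory Defs
  imports Complex_Main "HOL-Library.Poly_Mapping" "HOL-Combinatorics.Permutations"
begin

section \<open>Graded vector spaces and multilinear maps\<close>

locale graded_vector_space = vector_space scale
  for scale :: "'k::field_char_0 \<Rightarrow> 'v::ab_group_add \<Rightarrow> 'v" +
  fixes V :: "nat \<Rightarrow> 'v set"
  assumes subspace_component: "subspace (V n)"
    and direct_sum:
      "\<exists>!f. (\<forall>n. f n \<in> V n) \<and> finite {n. f n \<noteq> 0} \<and> x = (\<Sum>n | f n \<noteq> 0. f n)"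

definition int_component :: "(nat \<Rightarrow> 'v::zero set) \<Rightarrow> int \<Rightarrow> 'v set" where
  "int_component V d = (if d < 0 then {0} else V (nat d))"

text \<open>A linear map on an \<open>n\<close>-fold tensor power is given as a multilinear map, taking its
  arguments as a list of length \<open>n\<close>; its values on other lists are irrelevant.\<close>

definition multilinear ::
  "('k::field \<Rightarrow> 'a::ab_group_add \<Rightarrow> 'a) \<Rightarrow> ('k \<Rightarrow> 'b::ab_group_add \<Rightarrow> 'b) \<Rightarrow> nat \<Rightarrow>
    ('a list \<Rightarrow> 'b) \<Rightarrow> bool" where
  "multilinear s1 s2 n f \<longleftrightarrow>
    (\<forall>xs ys. length xs + length ys + 1 = n \<longrightarrow> Vector_Spaces.linear s1 s2 (\<lambda>x. f (xs @ x # ys)))"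

section \<open>Unshuffles and Koszul signs\<close>

definition unshuffles :: "nat \<Rightarrow> nat \<Rightarrow> (nat \<Rightarrow> nat) set" where
  "unshuffles p q =
    {\<sigma>. \<sigma> permutes {1..p+q} \<and> strict_mono_on {1..p} \<sigma> \<and> strict_mono_on {p+1..p+q} \<sigma>}"

text \<open>In \<open>x\<^sub>1 \<cdots> x\<^sub>m = Ksgn(\<sigma>) x\<^bsub>\<sigma>(1)\<^esub> \<cdots> x\<^bsub>\<sigma>(m)\<^esub>\<close> exactly the pairs inverted by \<open>\<sigma>\<close> have to
  move past each other; \<open>d a\<close> is the degree of \<open>x\<^sub>a\<close>. See also \<open>koszul_sign_id\<close> and
  \<open>koszul_sign_swap\<close> below.\<close>

definition koszul_sign :: "(nat \<Rightarrow> nat) \<Rightarrow> nat \<Rightarrow> (nat \<Rightarrow> nat) \<Rightarrow> int" where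
  "koszul_sign d m \<sigma> =
    (\<Prod>(a, b) \<in> {(a, b). 1 \<le> a \<and> a < b \<and> b \<le> m \<and> \<sigma> b < \<sigma> a}. (-1) ^ (d (\<sigma> a) * d (\<sigma> b)))"

section \<open>Lod-infinity algebras\<close>

definition Lod_infty ::
  "('k::field_char_0 \<Rightarrow> 'a::ab_group_add \<Rightarrow> 'a) \<Rightarrow> (nat \<Rightarrow> 'a set) \<Rightarrow>
    (nat \<Rightarrow> 'a list \<Rightarrow> 'a) \<Rightarrow> bool" where
  "Lod_infty scale L l \<longleftrightarrow>
    graded_vector_space scale L \<and>
    (\<forall>k\<ge>1. multilinear scale scale k (l k)) \<and>
    (\<forall>k\<ge>1. \<forall>d x. (\<forall>a\<in>{1..k}. x a \<in> L (d a)) \<longrightarrow>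
      l k (map x [1..<k+1]) \<in> int_component L (int (\<Sum>a=1..k. d a) + int k - 2)) \<and>
    (\<forall>n\<ge>1. \<forall>d x. (\<forall>a\<in>{1..n}. x a \<in> L (d a)) \<longrightarrow>
      (\<Sum>(i, j) \<in> {(i, j). 1 \<le> i \<and> 1 \<le> j \<and> i + j = n + 1}. \<Sum>k = j..n. \<Sum>\<sigma> \<in> unshuffles (k - j) (j - 1).
        scale (of_int ((-1) ^ ((k + 1 - j) * (j - 1)) * (-1) ^ (j * (\<Sum>a=1..k-j. d (\<sigma> a)))
                 * sign \<sigma> * koszul_sign d (k - 1) \<sigma>))
          (l i (map (\<lambda>a. x (\<sigma> a)) [1..<k-j+1]
                @ [l j (map (\<lambda>a. x (\<sigma> a)) [k+1-j..<k] @ [x k])]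
                @ map x [k+1..<n+1]))) = 0)"

section \<open>The graded exterior square\<close>

text \<open>The free vector space on \<open>'b\<close> is the type of finitely supported functions
  \<open>'b \<Rightarrow>\<^sub>0 'k\<close>.\<close>

definition free_scale :: "'k::field \<Rightarrow> ('b \<Rightarrow>\<^sub>0 'k) \<Rightarrow> ('b \<Rightarrow>\<^sub>0 'k)" where
  "free_scale r c = Poly_Mapping.map ((*) r) c"

definition free_extend ::
  "('k::field \<Rightarrow> 'w::ab_group_add \<Rightarrow> 'w) \<Rightarrow> ('b \<Rightarrow> 'w) \<Rightarrow> ('b \<Rightarrow>\<^sub>0 'k) \<Rightarrow> 'w" where
  "free_extend s f c = (\<Sum>b \<in> Poly_Mapping.keys c. s (Poly_Mapping.lookup c b) (f b))"

definition ext2_relations ::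
  "('k::field \<Rightarrow> 'v::ab_group_add \<Rightarrow> 'v) \<Rightarrow> (nat \<Rightarrow> 'v set) \<Rightarrow> ('v \<times> 'v \<Rightarrow>\<^sub>0 'k) set" where
  "ext2_relations scale V =
    (let e = (\<lambda>x y. Poly_Mapping.single (x, y) 1) in
      {e (x + x') y - e x y - e x' y | x x' y. True} \<union>
      {e x (y + y') - e x y - e x y' | x y y'. True} \<union>
      {e (scale r x) y - free_scale r (e x y) | r x y. True} \<union>
      {e x (scale r y) - free_scale r (e x y) | r x y. True} \<union>
      {e x y + free_scale ((-1) ^ (p * q)) (e y x) | x y p q. x \<in> V p \<and> y \<in> V q})"

text \<open>A type depending on the grading \<open>V\<close> cannot be formed in HOL, so the exterior square is an
  arbitrary vector space \<open>'w\<close> with a map \<open>wedge\<close> presenting it as the quotient of the free vector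
  space on \<open>'v \<times> 'v\<close> by the bilinearity and graded skew-symmetry relations. The lemma
  \<open>universal_property\<close> below shows that this determines \<open>('w, wedge)\<close> up to unique isomorphism.\<close>

locale graded_exterior_square =
  V: graded_vector_space scaleV V + W: vector_space scaleW
  for scaleV :: "'k::field_char_0 \<Rightarrow> 'v::ab_group_add \<Rightarrow> 'v" and V :: "nat \<Rightarrow> 'v set"
    and scaleW :: "'k \<Rightarrow> 'w::ab_group_add \<Rightarrow> 'w" +
  fixes wedge :: "'v \<Rightarrow> 'v \<Rightarrow> 'w"
  assumes surj_free_extend: "surj (free_extend scaleW (\<lambda>(x, y). wedge x y))"
    and kernel_free_extend:
      "{c. free_extend scaleW (\<lambda>(x, y). wedge x y) c = 0}
        = module.span free_scale (ext2_relations scaleV V)"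

definition ext2_component ::
  "(nat \<Rightarrow> 'v set) \<Rightarrow> ('k::field \<Rightarrow> 'w::ab_group_add \<Rightarrow> 'w) \<Rightarrow> ('v \<Rightarrow> 'v \<Rightarrow> 'w) \<Rightarrow> nat \<Rightarrow> 'w set" where
  "ext2_component V scaleW wedge d =
    module.span scaleW {wedge x y | x y p q. x \<in> V p \<and> y \<in> V q \<and> p + q = d}"

section \<open>3-Lie-infinity algebras\<close>

text \<open>The operation \<open>l\<^bsub>2n+1\<^esub>\<close> is represented by \<open>l n\<close>, applied to a list of \<open>n\<close> elements of the
  exterior square \<open>'w\<close> and one element of \<open>'v\<close>; likewise \<open>induced_map \<dots> l n\<close> stands for the
  induced map with index \<open>2n+1\<close>, which takes \<open>n+1\<close> arguments.\<close>

definition is_induced_map ::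
  "(nat \<Rightarrow> 'v::ab_group_add set) \<Rightarrow> ('k::field_char_0 \<Rightarrow> 'w::ab_group_add \<Rightarrow> 'w) \<Rightarrow>
    ('v \<Rightarrow> 'v \<Rightarrow> 'w) \<Rightarrow> (nat \<Rightarrow> 'w list \<Rightarrow> 'v \<Rightarrow> 'v) \<Rightarrow> nat \<Rightarrow> ('w list \<Rightarrow> 'w) \<Rightarrow> bool" where
  "is_induced_map V scaleW wedge l n f \<longleftrightarrow>
    multilinear scaleW scaleW (n + 1) f \<and>
    (\<forall>p q x y. (\<forall>a\<in>{1..n+1}. x a \<in> V (p a) \<and> y a \<in> V (q a)) \<longrightarrow>
      (let X = (\<lambda>a. wedge (x a) (y a)) in
        f (map X [1..<n+2]) =
          scaleW ((-1) powi (int (p (n+1)) * (int (\<Sum>a=1..n. p a + q a) + int n - 1)))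
            (wedge (x (n+1)) (l n (map X [1..<n+1]) (y (n+1))))
          + wedge (l n (map X [1..<n+1]) (x (n+1))) (y (n+1))))"

text \<open>By \<open>ex_induced_map\<close> and \<open>is_induced_map_unique\<close> below, the choice is between maps
  that agree on all lists of length \<open>n+1\<close>, and there is such a map.\<close>

definition induced_map ::
  "(nat \<Rightarrow> 'v::ab_group_add set) \<Rightarrow> ('k::field_char_0 \<Rightarrow> 'w::ab_group_add \<Rightarrow> 'w) \<Rightarrow>
    ('v \<Rightarrow> 'v \<Rightarrow> 'w) \<Rightarrow> (nat \<Rightarrow> 'w list \<Rightarrow> 'v \<Rightarrow> 'v) \<Rightarrow> nat \<Rightarrow> 'w list \<Rightarrow> 'w" where
  "induced_map V scaleW wedge l n = (SOME f. is_induced_map V scaleW wedge l n f)"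

text \<open>Linear maps \<open>(\<and>\<^sup>2V)\<^bsup>\<otimes>n\<^esup> \<and> V \<rightarrow> V\<close> of degree \<open>n - 1\<close>. Skew-symmetry in the two entries of the
  last element of \<open>'w\<close> is automatic, so that full skew-symmetry in the last three entries amounts
  to the transposition of the last two.\<close>

definition three_Lie_operations ::
  "('k::field_char_0 \<Rightarrow> 'v::ab_group_add \<Rightarrow> 'v) \<Rightarrow> (nat \<Rightarrow> 'v set) \<Rightarrow>
    ('k \<Rightarrow> 'w::ab_group_add \<Rightarrow> 'w) \<Rightarrow> ('v \<Rightarrow> 'v \<Rightarrow> 'w) \<Rightarrow> (nat \<Rightarrow> 'w list \<Rightarrow> 'v \<Rightarrow> 'v) \<Rightarrow> bool" where
  "three_Lie_operations scaleV V scaleW wedge l \<longleftrightarrow>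
    (\<forall>n x. multilinear scaleW scaleV n (\<lambda>Xs. l n Xs x)) \<and>
    (\<forall>n Xs. length Xs = n \<longrightarrow> Vector_Spaces.linear scaleV scaleV (l n Xs)) \<and>
    (\<forall>n Xs p q r x y z. length Xs = n \<and> x \<in> V p \<and> y \<in> V q \<and> z \<in> V r \<longrightarrow>
      l (n + 1) (Xs @ [wedge x y]) z
        = scaleV (- ((-1) ^ (q * r))) (l (n + 1) (Xs @ [wedge x z]) y)) \<and>
    (\<forall>n d X p x. (\<forall>a\<in>{1..n}. X a \<in> ext2_component V scaleW wedge (d a)) \<and> x \<in> V p \<longrightarrow>
      l n (map X [1..<n+1]) x
        \<in> int_component V (int (\<Sum>a=1..n. d a) + int p + int n - 1))"

definition three_Lie_infty ::
  "('k::field_char_0 \<Rightarrow> 'v::ab_group_add \<Rightarrow> 'v) \<Rightarrow> (nat \<Rightarrow> 'v set) \<Rightarrow>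
    ('k \<Rightarrow> 'w::ab_group_add \<Rightarrow> 'w) \<Rightarrow> ('v \<Rightarrow> 'v \<Rightarrow> 'w) \<Rightarrow> (nat \<Rightarrow> 'w list \<Rightarrow> 'v \<Rightarrow> 'v) \<Rightarrow> bool" where
  "three_Lie_infty scaleV V scaleW wedge l \<longleftrightarrow>
    graded_vector_space scaleV V \<and>
    three_Lie_operations scaleV V scaleW wedge l \<and>
    (\<forall>n\<ge>1. \<forall>d X p x. (\<forall>a\<in>{1..n-1}. X a \<in> ext2_component V scaleW wedge (d a)) \<and> x \<in> V p \<longrightarrow>
      (\<Sum>(i, j) \<in> {(i, j). i + j = n - 1}. \<Sum>k = j+1..n-1. \<Sum>\<sigma> \<in> unshuffles (k - j - 1) j.
        scaleV (of_int ((-1) ^ ((k - j) * j) * (-1) ^ ((j + 1) * (\<Sum>a=1..k-j-1. d (\<sigma> a)))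
                  * sign \<sigma> * koszul_sign d (k - 1) \<sigma>))
          (l i (map (\<lambda>a. X (\<sigma> a)) [1..<k-j]
                @ [induced_map V scaleW wedge l j (map (\<lambda>a. X (\<sigma> a)) [k-j..<k] @ [X k])]
                @ map X [k+1..<n]) x))
      + (\<Sum>(i, j) \<in> {(i, j). i + j = n - 1}. \<Sum>\<sigma> \<in> unshuffles i j.
        scaleV (of_int ((-1) ^ ((i + 1) * j) * (-1) ^ ((j + 1) * (\<Sum>a=1..i. d (\<sigma> a)))
                  * sign \<sigma> * koszul_sign d (n - 1) \<sigma>))
          (l i (map (\<lambda>a. X (\<sigma> a)) [1..<i+1]) (l j (map (\<lambda>a. X (\<sigma> a)) [i+1..<n]) x)))
      = 0)"

section \<open>Adequacy of the definitions\<close>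

lemma koszul_sign_id: "koszul_sign d m id = 1"
  unfolding koszul_sign_def by (intro prod.neutral) auto

lemma koszul_sign_swap:
  assumes "\<sigma> permutes {1..m}" and "1 \<le> a" and "a < m"
  shows "koszul_sign d m (\<sigma> \<circ> transpose a (a + 1))
           = (-1) ^ (d (\<sigma> a) * d (\<sigma> (a + 1))) * koszul_sign d m \<sigma>"
proof -
  define \<tau> where "\<tau> = transpose a (a + 1)"
  define F where "F = (\<lambda>(\<rho> :: nat \<Rightarrow> nat) (b, c). (-1 :: int) ^ (d (\<rho> b) * d (\<rho> c)))"
  define I where "I = (\<lambda>\<rho> :: nat \<Rightarrow> nat. {(b, c). 1 \<le> b \<and> b < c \<and> c \<le> m \<and> \<rho> c < \<rho> b})"
  have ks: "koszul_sign d m \<rho> = prod (F \<rho>) (I \<rho>)" for \<rho>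
    unfolding koszul_sign_def F_def I_def by simp
  have fin: "finite (I \<rho>)" for \<rho>
    by (rule finite_subset[of _ "{1..m} \<times> {1..m}"]) (auto simp: I_def)
  have inj: "\<sigma> a \<noteq> \<sigma> (a + 1)"
    using permutes_inj[OF assms(1)] by (metis injD n_not_Suc_n Suc_eq_plus1)
  have \<tau>: "\<tau> x = (if x = a then a + 1 else if x = a + 1 then a else x)" for x
    by (simp add: \<tau>_def transpose_def)
  have tt: "\<tau> (\<tau> x) = x" for x by (simp add: \<tau>)
  have mono: "\<tau> b < \<tau> c" if "b < c" "\<not> (b = a \<and> c = a + 1)" for b c
    using that unfolding \<tau> by (auto split: if_split)
  have range: "Suc 0 \<le> \<tau> b \<longleftrightarrow> Suc 0 \<le> b" "\<tau> b \<le> m \<longleftrightarrow> b \<le> m" for b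
    using assms(2,3) unfolding \<tau> by (simp_all split: if_split)
  have ne: "\<tau> c \<noteq> Suc a" if "b < c" "\<tau> b = a" for b c
    using that unfolding \<tau> by (auto split: if_splits)
  have bij: "prod (F (\<sigma> \<circ> \<tau>)) (I (\<sigma> \<circ> \<tau>) - {(a, a+1)}) = prod (F \<sigma>) (I \<sigma> - {(a, a+1)})"
  proof (rule prod.reindex_bij_witness[of _ "map_prod \<tau> \<tau>" "map_prod \<tau> \<tau>"])
    show "map_prod \<tau> \<tau> bc \<in> I \<sigma> - {(a, a+1)}" if "bc \<in> I (\<sigma> \<circ> \<tau>) - {(a, a+1)}" for bc
      using that by (cases bc) (auto simp: I_def range mono dest: ne)
    show "map_prod \<tau> \<tau> bc \<in> I (\<sigma> \<circ> \<tau>) - {(a, a+1)}" if "bc \<in> I \<sigma> - {(a, a+1)}" for bc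
      using that by (cases bc) (auto simp: I_def range mono tt dest: ne)
  qed (simp_all add: F_def tt case_prod_unfold prod.map_comp comp_def prod.map_ident)
  have split: "prod (F \<rho>) (I \<rho>)
      = (if \<rho> (a + 1) < \<rho> a then F \<rho> (a, a + 1) else 1) * prod (F \<rho>) (I \<rho> - {(a, a+1)})" for \<rho>
  proof (cases "\<rho> (a + 1) < \<rho> a")
    case True
    then have "(a, a + 1) \<in> I \<rho>" using assms(2,3) by (auto simp: I_def)
    then show ?thesis using True by (simp add: prod.remove[OF fin])
  next
    case False
    then have "I \<rho> - {(a, a + 1)} = I \<rho>" by (auto simp: I_def)
    then show ?thesis using False by simp
  qed
  have at: "(\<sigma> \<circ> \<tau>) a = \<sigma> (a + 1)" "(\<sigma> \<circ> \<tau>) (a + 1) = \<sigma> a" by (simp_all add: \<tau>)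
  define u :: int where "u = (-1) ^ (d (\<sigma> a) * d (\<sigma> (a + 1)))"
  have u: "F \<sigma> (a, a + 1) = u" "F (\<sigma> \<circ> \<tau>) (a, a + 1) = u" "u * u = 1"
    unfolding F_def prod.case at u_def by (simp_all add: mult.commute flip: power_mult_distrib)
  have "koszul_sign d m (\<sigma> \<circ> \<tau>) = u * koszul_sign d m \<sigma>"
    unfolding ks split[of "\<sigma> \<circ> \<tau>"] split[of \<sigma>] bij at u(1,2)
    using inj u(3) by (cases "\<sigma> a < \<sigma> (a + 1)") (simp_all flip: mult.assoc)
  then show ?thesis by (simp only: \<tau>_def u_def)
qed

lemma lookup_free_scale [simp]:
  "Poly_Mapping.lookup (free_scale r c) b = r * Poly_Mapping.lookup c b"
  unfolding free_scale_def by (cases "Poly_Mapping.lookup c b = 0") (auto simp: map.rep_eq when_def)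

interpretation free: vector_space "free_scale :: 'k::field \<Rightarrow> ('b \<Rightarrow>\<^sub>0 'k) \<Rightarrow> _"
  by unfold_locales
    (auto intro!: poly_mapping_eqI simp: lookup_add algebra_simps)

context vector_space
begin

lemma free_extend_superset:
  assumes "finite A" "Poly_Mapping.keys c \<subseteq> A"
  shows "free_extend scale f c = (\<Sum>b\<in>A. scale (Poly_Mapping.lookup c b) (f b))"
  unfolding free_extend_def
  by (rule sum.mono_neutral_left[OF assms]) (auto simp: in_keys_iff)

lemma linear_free_extend: "Vector_Spaces.linear free_scale scale (free_extend scale f)"
  unfolding Vector_Spaces.linear_iff
proof (intro conjI allI)
  show "free_extend scale f (c + c') = free_extend scale f c + free_extend scale f c'" for c c'
  proof -
    let ?A = "Poly_Mapping.keys c \<union> Poly_Mapping.keys c'"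
    have "Poly_Mapping.keys (c + c') \<subseteq> ?A" by (rule keys_add)
    then show ?thesis
      by (simp add: free_extend_superset[of ?A] lookup_add scale_left_distrib sum.distrib)
  qed
  show "free_extend scale f (free_scale r c) = scale r (free_extend scale f c)" for r c
  proof -
    have "Poly_Mapping.keys (free_scale r c) \<subseteq> Poly_Mapping.keys c"
      by (auto simp: in_keys_iff)
    then show ?thesis
      by (simp add: free_extend_superset[of "Poly_Mapping.keys c"] scale_sum_right)
  qed
qed (unfold_locales)

lemma free_extend_single [simp]: "free_extend scale f (Poly_Mapping.single b r) = scale r (f b)"
  by (subst free_extend_superset[of "{b}"]) (auto simp: in_keys_iff lookup_single when_def)

end

context graded_vector_space
begin

lemma span_homogeneous: "span (\<Union>n. V n) = UNIV"
proof -
  have "x \<in> span (\<Union>n. V n)" for x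
  proof -
    obtain f where f: "\<forall>n. f n \<in> V n" "x = (\<Sum>n | f n \<noteq> 0. f n)"
      using direct_sum[of x] by blast
    show ?thesis
      unfolding f(2) by (intro span_sum span_base) (use f(1) in blast)
  qed
  then show ?thesis by auto
qed

text \<open>The projection onto the sum of the components of even degree.\<close>

lemma ex_even_projection:
  "\<exists>e. Vector_Spaces.linear scale scale e \<and> (\<forall>n. \<forall>x\<in>V n. e x = (if even n then x else 0))"
proof -
  define P where "P = (\<lambda>x f. (\<forall>n. f n \<in> V n) \<and> finite {n. f n \<noteq> 0} \<and> x = (\<Sum>n | f n \<noteq> 0. f n))"
  define D where "D = (\<lambda>x. THE f. P x f)"
  have ex1: "\<exists>!f. P x f" for x unfolding P_def by (rule direct_sum)
  have PD: "P x (D x)" for x unfolding D_def by (rule theI'[OF ex1])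
  have DP: "D x = f" if "P x f" for x f unfolding D_def by (rule the1_equality[of "P x", OF ex1 that])
  have D_in: "D x n \<in> V n" and fin: "finite {n. D x n \<noteq> 0}"
    and D_sum: "(\<Sum>n | D x n \<noteq> 0. D x n) = x" for x n
    using PD[of x, unfolded P_def] by (elim conjE; simp)+
  have sup: "(\<Sum>n | f n \<noteq> 0. f n) = sum f A" if "finite A" "{n. f n \<noteq> 0} \<subseteq> A"
    for f :: "nat \<Rightarrow> 'v" and A
    by (rule sum.mono_neutral_left) (use that in auto)
  have D_add: "D (x + y) = (\<lambda>n. D x n + D y n)" for x y
  proof (rule DP)
    let ?A = "{n. D x n \<noteq> 0} \<union> {n. D y n \<noteq> 0}"
    have A: "finite ?A" "{n. D x n + D y n \<noteq> 0} \<subseteq> ?A" using fin by auto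
    have "sum (D x) ?A = x" "sum (D y) ?A = y"
      using trans[OF sup[symmetric, of ?A "D x"] D_sum] trans[OF sup[symmetric, of ?A "D y"] D_sum]
        A(1) by blast+
    then have "x + y = (\<Sum>n\<in>?A. D x n + D y n)" unfolding sum.distrib by simp
    also have "\<dots> = (\<Sum>n | D x n + D y n \<noteq> 0. D x n + D y n)" by (rule sup[symmetric, OF A])
    finally show "P (x + y) (\<lambda>n. D x n + D y n)"
      unfolding P_def using finite_subset[OF A(2,1)]
      by (intro conjI allI subspace_add[OF subspace_component] D_in)
  qed
  have D_scale: "D (scale r x) = (\<lambda>n. scale r (D x n))" for r x
  proof (rule DP)
    let ?A = "{n. D x n \<noteq> 0}"
    have A: "finite ?A" "{n. scale r (D x n) \<noteq> 0} \<subseteq> ?A" using fin by auto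
    have "scale r x = (\<Sum>n\<in>?A. scale r (D x n))" unfolding scale_sum_right[symmetric] D_sum ..
    also have "\<dots> = (\<Sum>n | scale r (D x n) \<noteq> 0. scale r (D x n))" by (rule sup[symmetric, OF A])
    finally show "P (scale r x) (\<lambda>n. scale r (D x n))"
      unfolding P_def using finite_subset[OF A(2,1)]
      by (intro conjI allI subspace_scale[OF subspace_component] D_in)
  qed
  have D_hom: "D x = (\<lambda>m. if m = n then x else 0)" if "x \<in> V n" for x n
  proof (rule DP)
    have "(\<Sum>m | (if m = n then x else 0) \<noteq> 0. if m = n then x else 0)
        = (\<Sum>m\<in>{n}. if m = n then x else 0)"
      by (rule sup) auto
    moreover have "{m. (if m = n then x else 0) \<noteq> 0} \<subseteq> {n}" by auto
    ultimately show "P x (\<lambda>m. if m = n then x else 0)"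
      using that subspace_0[OF subspace_component] finite_subset[of _ "{n}"]
      by (auto simp: P_def)
  qed
  define e where "e = (\<lambda>x. \<Sum>n | D x n \<noteq> 0. if even n then D x n else 0)"
  have e_sup: "e x = (\<Sum>n\<in>A. if even n then D x n else 0)"
    if "finite A" "{n. D x n \<noteq> 0} \<subseteq> A" for x A
    unfolding e_def by (rule sum.mono_neutral_left) (use that in auto)
  have "Vector_Spaces.linear scale scale e"
    unfolding Vector_Spaces.linear_iff
  proof (intro conjI allI)
    show "e (x + y) = e x + e y" for x y
    proof -
      let ?A = "{n. D x n \<noteq> 0} \<union> {n. D y n \<noteq> 0}"
      have "{n. D (x + y) n \<noteq> 0} \<subseteq> ?A" by (auto simp: D_add)
      then show ?thesis
        using fin by (subst (1 2 3) e_sup[of ?A])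
          (auto simp: D_add sum.distrib[symmetric] intro!: sum.cong)
    qed
    show "e (scale r x) = scale r (e x)" for r x
    proof -
      let ?A = "{n. D x n \<noteq> 0}"
      have "{n. D (scale r x) n \<noteq> 0} \<subseteq> ?A" by (auto simp: D_scale)
      then show ?thesis
        using fin by (subst (1 2) e_sup[of ?A])
          (auto simp: D_scale scale_sum_right intro!: sum.cong)
    qed
  qed (unfold_locales)
  moreover have "e x = (if even n then x else 0)" if "x \<in> V n" for n x
    using that by (subst e_sup[of "{n}"]) (auto simp: D_hom split: if_splits)
  ultimately show ?thesis by blast
qed

end

definition graded_skew_bilinear ::
  "('k::field \<Rightarrow> 'v::ab_group_add \<Rightarrow> 'v) \<Rightarrow> (nat \<Rightarrow> 'v set) \<Rightarrow> ('k \<Rightarrow> 'u::ab_group_add \<Rightarrow> 'u) \<Rightarrow>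
    ('v \<Rightarrow> 'v \<Rightarrow> 'u) \<Rightarrow> bool" where
  "graded_skew_bilinear scale V scaleU f \<longleftrightarrow>
    (\<forall>x. Vector_Spaces.linear scale scaleU (f x)) \<and>
    (\<forall>y. Vector_Spaces.linear scale scaleU (\<lambda>x. f x y)) \<and>
    (\<forall>p q x y. x \<in> V p \<and> y \<in> V q \<longrightarrow> f x y = - scaleU ((-1) ^ (p * q)) (f y x))"

context graded_exterior_square
begin

lemma linear_wedge:
  "Vector_Spaces.linear free_scale scaleW (free_extend scaleW (\<lambda>(x, y). wedge x y))"
  by (rule W.linear_free_extend)

lemma relation_vanishes:
  assumes "c \<in> ext2_relations scaleV V"
  shows "free_extend scaleW (\<lambda>(x, y). wedge x y) c = 0"
  using kernel_free_extend free.span_base[OF assms] by blast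

lemma graded_skew_bilinear_wedge: "graded_skew_bilinear scaleV V scaleW wedge"
proof -
  let ?F = "free_extend scaleW (\<lambda>(x, y). wedge x y)"
  let ?e = "\<lambda>x y. Poly_Mapping.single (x, y) 1"
  interpret F: Vector_Spaces.linear free_scale scaleW ?F by (rule linear_wedge)
  note F = relation_vanishes[unfolded ext2_relations_def Let_def]
  have "?F (?e (x + x') y - ?e x y - ?e x' y) = 0" for x x' y by (rule F) blast
  then have 1: "wedge (x + x') y = wedge x y + wedge x' y" for x x' y
    by (simp add: F.diff) (simp add: algebra_simps)
  have "?F (?e x (y + y') - ?e x y - ?e x y') = 0" for x y y' by (rule F) blast
  then have 2: "wedge x (y + y') = wedge x y + wedge x y'" for x y y'
    by (simp add: F.diff) (simp add: algebra_simps)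
  have "?F (?e (scaleV r x) y - free_scale r (?e x y)) = 0" for r x y by (rule F) blast
  then have 3: "wedge (scaleV r x) y = scaleW r (wedge x y)" for r x y
    by (simp add: F.diff F.scale)
  have "?F (?e x (scaleV r y) - free_scale r (?e x y)) = 0" for r x y by (rule F) blast
  then have 4: "wedge x (scaleV r y) = scaleW r (wedge x y)" for r x y
    by (simp add: F.diff F.scale)
  have 5: "wedge x y = - scaleW ((-1) ^ (p * q)) (wedge y x)" if "x \<in> V p" "y \<in> V q" for p q x y
  proof -
    have "?F (?e x y + free_scale ((-1) ^ (p * q)) (?e y x)) = 0" by (rule F) (use that in blast)
    then show ?thesis by (simp add: F.add F.scale eq_neg_iff_add_eq_0)
  qed
  show ?thesis
    unfolding graded_skew_bilinear_def Vector_Spaces.linear_iff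
    by (auto simp: 1 2 3 4 intro: 5 V.vector_space_axioms W.vector_space_axioms)
qed

lemma span_wedge: "W.span (range (\<lambda>(x, y). wedge x y)) = UNIV"
proof -
  have "w \<in> W.span (range (\<lambda>(x, y). wedge x y))" for w
  proof -
    obtain c where "w = free_extend scaleW (\<lambda>(x, y). wedge x y) c"
      using surj_free_extend by (metis surjD)
    then show ?thesis
      unfolding free_extend_def by (auto intro!: W.span_sum W.span_scale intro: W.span_base)
  qed
  then show ?thesis by auto
qed

theorem universal_property:
  fixes scaleU :: "'k \<Rightarrow> 'u::ab_group_add \<Rightarrow> 'u"
  assumes "graded_skew_bilinear scaleV V scaleU f"
  shows "\<exists>!g. Vector_Spaces.linear scaleW scaleU g \<and> (\<forall>x y. g (wedge x y) = f x y)"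
proof -
  let ?F = "free_extend scaleW (\<lambda>(x, y). wedge x y)"
  let ?G = "free_extend scaleU (\<lambda>(x, y). f x y)"
  have f: "f (x + x') y = f x y + f x' y" "f x (y + y') = f x y + f x y'"
    "f (scaleV r x) y = scaleU r (f x y)" "f x (scaleV r y) = scaleU r (f x y)"
    "vector_space scaleU" for x x' y y' r
    using assms unfolding graded_skew_bilinear_def Vector_Spaces.linear_iff by blast+
  have skew: "f x y + scaleU ((-1) ^ (p * q)) (f y x) = 0" if "x \<in> V p" "y \<in> V q" for p q x y
    using assms that unfolding graded_skew_bilinear_def by (metis add.left_inverse)
  interpret U: vector_space scaleU by (rule f)
  interpret F: Vector_Spaces.linear free_scale scaleW ?F by (rule linear_wedge)
  interpret G: Vector_Spaces.linear free_scale scaleU ?G by (rule U.linear_free_extend)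
  have G0: "?G c = 0" if "c \<in> ext2_relations scaleV V" for c
    using that unfolding ext2_relations_def Let_def
    by (auto simp: G.diff G.add G.scale f skew)
  have ker: "?G c = 0" if "?F c = 0" for c
  proof -
    have "c \<in> free.span (ext2_relations scaleV V)" using that kernel_free_extend by blast
    then show ?thesis using G0 by (rule G.eq_0_on_span[rotated])
  qed
  have eq: "?G c = ?G c'" if "?F c = ?F c'" for c c'
    using ker[of "c - c'"] that by (simp add: F.diff G.diff)
  define g where "g = (\<lambda>w. ?G (inv ?F w))"
  have gF: "g (?F c) = ?G c" for c
    unfolding g_def by (rule eq) (simp add: surj_f_inv_f[OF surj_free_extend])
  have "Vector_Spaces.linear scaleW scaleU g"
    unfolding Vector_Spaces.linear_iff
  proof (intro conjI allI)
    show "g (w + w') = g w + g w'" for w w'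
    proof -
      obtain c c' where w: "w = ?F c" "w' = ?F c'" using surj_free_extend by (metis surjD)
      show ?thesis unfolding w F.add[symmetric] gF by (rule G.add)
    qed
    show "g (scaleW r w) = scaleU r (g w)" for r w
    proof -
      obtain c where w: "w = ?F c" using surj_free_extend by (metis surjD)
      show ?thesis unfolding w F.scale[symmetric] gF by (rule G.scale)
    qed
  qed (unfold_locales)
  moreover have "g (wedge x y) = f x y" for x y
    using gF[of "Poly_Mapping.single (x, y) 1"] by simp
  moreover have "h = h'"
    if "Vector_Spaces.linear scaleW scaleU h" "\<forall>x y. h (wedge x y) = f x y"
      "Vector_Spaces.linear scaleW scaleU h'" "\<forall>x y. h' (wedge x y) = f x y" for h h'
  proof
    interpret WU: vector_space_pair scaleW scaleU by unfold_locales
    fix w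
    show "h w = h' w"
      by (rule WU.linear_eq_on[OF that(1,3), of w "range (\<lambda>(x, y). wedge x y)"])
        (auto simp: that(2,4) span_wedge)
  qed
  ultimately show ?thesis by blast
qed

end

lemma multilinearD:
  assumes "multilinear s1 s2 n f" and "length xs + length ys + 1 = n"
  shows "Vector_Spaces.linear s1 s2 (\<lambda>x. f (xs @ x # ys))"
  using assms unfolding multilinear_def by blast

lemma multilinear_compose:
  assumes "multilinear s1 s2 n f" "Vector_Spaces.linear s2 s3 g"
  shows "multilinear s1 s3 n (\<lambda>xs. g (f xs))"
  using assms unfolding multilinear_def Vector_Spaces.linear_iff by simp

lemma multilinear_map:
  assumes "multilinear s1 s2 n f" "Vector_Spaces.linear s1 s1 g"
  shows "multilinear s1 s2 n (\<lambda>xs. f (map g xs))"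
  using assms unfolding multilinear_def Vector_Spaces.linear_iff by simp

lemma multilinear_add:
  assumes "multilinear s1 s2 n f" "multilinear s1 s2 n g"
  shows "multilinear s1 s2 n (\<lambda>xs. f xs + g xs)"
  unfolding multilinear_def
proof (intro allI impI)
  fix xs ys :: "'b list" assume n: "length xs + length ys + 1 = n"
  note fg = assms[THEN multilinearD, OF n]
  interpret vector_space_pair s1 s2
    using fg(1) unfolding Vector_Spaces.linear_def vector_space_pair_def by blast
  show "Vector_Spaces.linear s1 s2 (\<lambda>x. f (xs @ x # ys) + g (xs @ x # ys))"
    using fg by (rule linear_compose_add)
qed

lemma multilinear_eq_0:
  assumes f: "multilinear s1 s2 n f" and "module.span s1 S = UNIV"
    and f0: "\<And>xs. length xs = n \<Longrightarrow> set xs \<subseteq> S \<Longrightarrow> f xs = 0" and "length xs = n"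
  shows "f xs = 0"
proof -
  have "f (ys @ zs) = 0" if "length ys + length zs = n" "set zs \<subseteq> S" for ys zs
    using that
  proof (induction ys arbitrary: zs rule: rev_induct)
    case Nil
    then show ?case using f0 by simp
  next
    case (snoc y ys)
    have lin: "Vector_Spaces.linear s1 s2 (\<lambda>y. f (ys @ y # zs))"
      by (rule multilinearD[OF f]) (use snoc.prems in simp)
    interpret L: Vector_Spaces.linear s1 s2 "\<lambda>y. f (ys @ y # zs)" by (rule lin)
    have "y \<in> module.span s1 S" using assms(2) by simp
    then have "f (ys @ y # zs) = 0"
      by (rule L.eq_0_on_span[rotated]) (use snoc in simp)
    then show ?case by simp
  qed
  from this[of xs "[]"] show ?thesis using assms(4) by simp
qed

lemma multilinear_scale:
  assumes f: "multilinear s1 s2 n f" and "vector_space s2"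
  shows "length xs + length as = n \<Longrightarrow>
    f (xs @ map (\<lambda>a. s1 (c a) (x a)) as) = s2 (\<Prod>a\<leftarrow>as. c a) (f (xs @ map x as))"
proof (induction as arbitrary: xs)
  case Nil
  interpret vector_space s2 by fact
  show ?case by simp
next
  case (Cons a as)
  interpret vector_space s2 by fact
  have "f (xs @ s1 (c a) (x a) # map (\<lambda>a. s1 (c a) (x a)) as)
      = s2 (c a) (f (xs @ x a # map (\<lambda>a. s1 (c a) (x a)) as))"
    using multilinearD[OF f, of xs "map (\<lambda>a. s1 (c a) (x a)) as"] Cons.prems
    unfolding Vector_Spaces.linear_iff by simp
  moreover have "f ((xs @ [x a]) @ map (\<lambda>a. s1 (c a) (x a)) as)
      = s2 (\<Prod>a\<leftarrow>as. c a) (f ((xs @ [x a]) @ map x as))"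
    by (rule Cons.IH) (use Cons.prems in simp)
  ultimately show ?case by simp
qed

lemma minus_one_powi: "(-1 :: 'k::field) powi m = (if even m then 1 else -1)"
proof (cases m)
  case (nonneg n)
  then show ?thesis by (simp add: minus_one_power_iff)
next
  case (neg n)
  have "(-1 :: 'k) powi m = inverse ((-1) ^ Suc n)"
    unfolding neg power_int_minus by (simp only: power_int_of_nat)
  then show ?thesis by (auto simp: neg minus_one_power_iff)
qed

context graded_exterior_square
begin

lemma wedge_simps:
  "wedge (x + x') y = wedge x y + wedge x' y" "wedge x (y + y') = wedge x y + wedge x y'"
  "wedge (scaleV r x) y = scaleW r (wedge x y)" "wedge x (scaleV r y) = scaleW r (wedge x y)"
  "wedge 0 y = 0" "wedge x 0 = 0" "wedge (- x) y = - wedge x y" "wedge x (- y) = - wedge x y"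
proof -
  have L: "Vector_Spaces.linear scaleV scaleW (wedge x)"
    and R: "Vector_Spaces.linear scaleV scaleW (\<lambda>x. wedge x y)" for x y
    using graded_skew_bilinear_wedge by (auto simp: graded_skew_bilinear_def)
  interpret L: Vector_Spaces.linear scaleV scaleW "wedge x" for x by (rule L)
  interpret R: Vector_Spaces.linear scaleV scaleW "\<lambda>x. wedge x y" for y by (rule R)
  show "wedge (x + x') y = wedge x y + wedge x' y" "wedge x (y + y') = wedge x y + wedge x y'"
    "wedge (scaleV r x) y = scaleW r (wedge x y)" "wedge x (scaleV r y) = scaleW r (wedge x y)"
    "wedge 0 y = 0" "wedge x 0 = 0" "wedge (- x) y = - wedge x y" "wedge x (- y) = - wedge x y"
    by (rule R.add L.add R.scale L.scale R.zero L.zero R.neg L.neg)+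
qed

lemma wedge_skew:
  assumes "x \<in> V p" "y \<in> V q"
  shows "wedge x y = - scaleW ((-1) ^ (p * q)) (wedge y x)"
  using graded_skew_bilinear_wedge assms unfolding graded_skew_bilinear_def by blast

lemma wedge_skew_int:
  assumes "x \<in> V p" "z \<in> int_component V m"
  shows "wedge z x = - scaleW ((-1) powi (int p * m)) (wedge x z)"
proof (cases "m < 0")
  case True
  then show ?thesis using assms by (simp add: int_component_def wedge_simps)
next
  case False
  then have "z \<in> V (nat m)" using assms by (simp add: int_component_def)
  then have "wedge z x = - scaleW ((-1) ^ (nat m * p)) (wedge x z)"
    by (rule wedge_skew) fact
  moreover have "((-1 :: 'k) ^ (nat m * p)) = (-1) powi (int p * m)"
    using False by (simp add: minus_one_powi minus_one_power_iff even_nat_iff)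
  ultimately show ?thesis by simp
qed

lemma span_homogeneous_wedge: "W.span {wedge x y | x y p q. x \<in> V p \<and> y \<in> V q} = UNIV"
  (is "W.span ?S = _")
proof -
  have L: "Vector_Spaces.linear scaleV scaleW (wedge x)"
    and R: "Vector_Spaces.linear scaleV scaleW (\<lambda>x. wedge x y)" for x y
    using graded_skew_bilinear_wedge by (auto simp: graded_skew_bilinear_def)
  interpret L: Vector_Spaces.linear scaleV scaleW "wedge x" for x by (rule L)
  interpret R: Vector_Spaces.linear scaleV scaleW "\<lambda>x. wedge x y" for y by (rule R)
  have 1: "wedge x y \<in> W.span ?S" if "x \<in> V p" for x p y
  proof -
    have "wedge x ` V.span (\<Union>n. V n) = W.span (wedge x ` (\<Union>n. V n))"
      by (rule L.span_image[symmetric])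
    also have "\<dots> \<subseteq> W.span ?S" by (rule W.span_mono) (use that in blast)
    finally show ?thesis unfolding V.span_homogeneous by blast
  qed
  have "wedge x y \<in> W.span ?S" for x y
  proof -
    have "(\<lambda>x. wedge x y) ` V.span (\<Union>n. V n) = W.span ((\<lambda>x. wedge x y) ` (\<Union>n. V n))"
      by (rule R.span_image[symmetric])
    also have "\<dots> \<subseteq> W.span ?S" by (rule W.span_minimal) (use 1 in auto)
    finally show ?thesis unfolding V.span_homogeneous by blast
  qed
  then have "W.span (range (\<lambda>(x, y). wedge x y)) \<subseteq> W.span ?S"
    by (intro W.span_minimal) auto
  then show ?thesis unfolding span_wedge by blast
qed

lemma homogeneous_wedge_list:
  assumes "length Xs = n" "set Xs \<subseteq> {wedge x y | x y p q. x \<in> V p \<and> y \<in> V q}"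
  obtains p q x y where "\<forall>a\<in>{1..n}. x a \<in> V (p a) \<and> y a \<in> V (q a)"
    and "Xs = map (\<lambda>a. wedge (x a) (y a)) [1..<n+1]"
proof -
  have "\<forall>a\<in>{1..n}. \<exists>x y p q. Xs ! (a - 1) = wedge x y \<and> x \<in> V p \<and> y \<in> V q"
  proof
    fix a assume "a \<in> {1..n}"
    then have "Xs ! (a - 1) \<in> set Xs" using assms(1) by (intro nth_mem) auto
    then show "\<exists>x y p q. Xs ! (a - 1) = wedge x y \<and> x \<in> V p \<and> y \<in> V q" using assms(2) by blast
  qed
  then have "\<exists>x y p q. \<forall>a\<in>{1..n}.
      Xs ! (a - 1) = wedge (x a) (y a) \<and> x a \<in> V (p a) \<and> y a \<in> V (q a)"
    by - ((drule bchoice, erule exE)+, intro exI)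
  then obtain x y p q where
    *: "\<forall>a\<in>{1..n}. Xs ! (a - 1) = wedge (x a) (y a) \<and> x a \<in> V (p a) \<and> y a \<in> V (q a)"
    by blast
  show thesis
  proof
    show "\<forall>a\<in>{1..n}. x a \<in> V (p a) \<and> y a \<in> V (q a)" using * by blast
    show "Xs = map (\<lambda>a. wedge (x a) (y a)) [1..<n+1]"
    proof (rule nth_equalityI)
      fix i assume "i < length Xs"
      then show "Xs ! i = map (\<lambda>a. wedge (x a) (y a)) [1..<n+1] ! i"
        using *[rule_format, of "i + 1"] assms(1) by (simp del: upt_Suc)
    qed (use assms in \<open>simp del: upt_Suc\<close>)
  qed
qed

theorem is_induced_map_unique:
  assumes f: "is_induced_map V scaleW wedge l n f" and g: "is_induced_map V scaleW wedge l n g"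
    and "length Xs = n + 1"
  shows "f Xs = g Xs"
proof -
  have neg: "Vector_Spaces.linear scaleW scaleW uminus"
    unfolding Vector_Spaces.linear_iff by (auto intro: W.vector_space_axioms)
  have fg: "multilinear scaleW scaleW (n + 1) f" "multilinear scaleW scaleW (n + 1) g"
    using f g by (simp_all add: is_induced_map_def)
  have "multilinear scaleW scaleW (n + 1) (\<lambda>Xs. f Xs + - g Xs)"
    by (rule multilinear_add[OF fg(1) multilinear_compose[OF fg(2) neg]])
  then have "f Xs + - g Xs = 0"
  proof (rule multilinear_eq_0[OF _ span_homogeneous_wedge])
    fix Xs assume "length Xs = n + 1"
      and "set Xs \<subseteq> {wedge x y | x y p q. x \<in> V p \<and> y \<in> V q}"
    then obtain p q x y where *: "\<forall>a\<in>{1..n+1}. x a \<in> V (p a) \<and> y a \<in> V (q a)"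
      and "Xs = map (\<lambda>a. wedge (x a) (y a)) [1..<n+1+1]"
      by (rule homogeneous_wedge_list)
    then have Xs: "Xs = map (\<lambda>a. wedge (x a) (y a)) [1..<n+2]" by simp
    note formula = is_induced_map_def[unfolded Let_def, THEN iffD1, THEN conjunct2,
        THEN spec[of _ p], THEN spec[of _ q], THEN spec[of _ x], THEN spec[of _ y],
        THEN mp, OF _ *]
    show "f Xs + - g Xs = 0"
      unfolding Xs formula[OF f] formula[OF g] by (rule right_minus)
  qed fact
  then show ?thesis by simp
qed

theorem ex_induced_map:
  assumes "three_Lie_operations scaleV V scaleW wedge l"
  shows "\<exists>f. is_induced_map V scaleW wedge l n f"
proof -
  obtain e where e: "Vector_Spaces.linear scaleV scaleV e"
    and e_hom: "\<And>m x. x \<in> V m \<Longrightarrow> e x = (if even m then x else 0)"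
    using V.ex_even_projection by blast
  interpret e: Vector_Spaces.linear scaleV scaleV e by (rule e)
  define s where "s x = e x + e x - x" for x
  have s_hom: "s x = scaleV ((-1) ^ m) x" if "x \<in> V m" for m x
    using e_hom[OF that] by (simp add: s_def minus_one_power_iff)
  have s_simps: "s (x + y) = s x + s y" "s (scaleV r x) = scaleV r (s x)" for x y r
    by (simp_all add: s_def e.add e.scale V.scale_right_distrib V.scale_right_diff_distrib)
  have "graded_skew_bilinear scaleV V scaleW (\<lambda>x y. wedge (s x) (s y))"
    unfolding graded_skew_bilinear_def Vector_Spaces.linear_iff
  proof (intro conjI allI impI)
    fix p q x y assume xy: "x \<in> V p \<and> y \<in> V q"
    then show "wedge (s x) (s y) = - scaleW ((-1) ^ (p * q)) (wedge (s y) (s x))"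
      by (simp add: s_hom[of x p] s_hom[of y q] wedge_skew[of x p y q] wedge_simps mult_ac)
  qed (auto simp: s_simps wedge_simps intro: V.vector_space_axioms W.vector_space_axioms)
  then obtain E where E: "Vector_Spaces.linear scaleW scaleW E"
    and E_wedge: "\<And>x y. E (wedge x y) = wedge (s x) (s y)"
    using universal_property by blast
  note ops = assms[unfolded three_Lie_operations_def, THEN conjunct1]
    assms[unfolded three_Lie_operations_def, THEN conjunct2, THEN conjunct1]
    assms[unfolded three_Lie_operations_def, THEN conjunct2, THEN conjunct2, THEN conjunct2]
  have l1: "multilinear scaleW scaleV n (\<lambda>Xs. l n Xs x)" for x
    by (rule ops(1)[THEN spec, THEN spec])
  have l2: "Vector_Spaces.linear scaleV scaleV (l n Xs)" if "length Xs = n" for Xs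
    by (rule ops(2)[THEN spec, THEN spec, THEN mp]) fact
  have l_deg: "l n (map X [1..<n+1]) x \<in> int_component V (int (\<Sum>a=1..n. d a) + int p + int n - 1)"
    if "\<forall>a\<in>{1..n}. X a \<in> ext2_component V scaleW wedge (d a)" "x \<in> V p" for X d x p
    by (rule ops(3)[THEN spec, THEN spec, THEN spec, THEN spec, THEN spec, THEN mp])
      (use that in blast)

  define G where "G Xs x y =
    wedge (e x) (l n Xs y)
      + scaleW ((-1) powi (int n - 1)) (wedge (x - e x) (l n (map E Xs) y))
      + wedge (l n Xs x) y" for Xs x y
  have wedge_linear: "Vector_Spaces.linear scaleV scaleW (wedge x)"
    "Vector_Spaces.linear scaleV scaleW (\<lambda>x. wedge x y)" for x y
    using graded_skew_bilinear_wedge by (auto simp: graded_skew_bilinear_def)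
  have scale_linear: "Vector_Spaces.linear scaleW scaleW (scaleW r)" for r
    unfolding Vector_Spaces.linear_iff
    by (auto simp: W.scale_right_distrib mult.commute intro: W.vector_space_axioms)
  have G_multilinear: "multilinear scaleW scaleW n (\<lambda>Xs. G Xs x y)" for x y
    unfolding G_def
    by (rule multilinear_add[OF multilinear_add[OF multilinear_compose[OF l1 wedge_linear(1)]
              multilinear_compose[OF multilinear_compose[OF multilinear_map[OF l1 E]
                wedge_linear(1)] scale_linear]]
          multilinear_compose[OF l1 wedge_linear(2)]])
  have G_hom: "G Xs x z =
      scaleW ((-1) powi (int p * (int (\<Sum>a=1..n. d a) + int n - 1))) (wedge x (l n Xs z))
      + wedge (l n Xs x) z"
    if Xs: "Xs = map (\<lambda>a. wedge (u a) (v a)) [1..<n+1]"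
      and uv: "\<forall>a\<in>{1..n}. u a \<in> V (h a) \<and> v a \<in> V (k a)" "\<forall>a. d a = h a + k a"
      and x: "x \<in> V p" for Xs u v h k d p x z
  proof -
    have "E (wedge (u a) (v a)) = scaleW ((-1) ^ d a) (wedge (u a) (v a))" if "a \<in> {1..n}" for a
    proof -
      have "u a \<in> V (h a)" "v a \<in> V (k a)" using uv(1) that by auto
      then show ?thesis
        by (simp add: E_wedge s_hom[of "u a" "h a"] s_hom[of "v a" "k a"] wedge_simps uv(2)
            power_add mult.commute)
    qed
    then have EX: "map E Xs = map (\<lambda>a. scaleW ((-1) ^ d a) (wedge (u a) (v a))) [1..<n+1]"
      unfolding Xs by (simp del: upt_Suc)
    have "l n (map E Xs) z = scaleV (\<Prod>a\<leftarrow>[1..<n+1]. (-1) ^ d a) (l n Xs z)"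
      using multilinear_scale[OF l1 V.vector_space_axioms, of "[]" "[1..<n+1]"]
      unfolding EX unfolding Xs by (simp del: upt_Suc)
    also have "(\<Prod>a\<leftarrow>[1..<n+1]. (-1 :: 'k) ^ d a) = (-1) ^ (\<Sum>a=1..n. d a)"
      by (induction n) (auto simp: power_add)
    finally show ?thesis
      using e_hom[OF x]
      by (auto simp: G_def wedge_simps minus_one_powi minus_one_power_iff simp del: of_nat_sum)
  qed
  have G_skew: "G Xs x y + scaleW ((-1) ^ (p * q)) (G Xs y x) = 0"
    if xy: "x \<in> V p" "y \<in> V q" and "length Xs = n" for Xs x y p q
  proof (rule multilinear_eq_0[OF _ span_homogeneous_wedge])
    show "multilinear scaleW scaleW n (\<lambda>Xs. G Xs x y + scaleW ((-1) ^ (p * q)) (G Xs y x))"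
      by (rule multilinear_add[OF G_multilinear multilinear_compose[OF G_multilinear scale_linear]])
    fix Xs assume "length Xs = n" "set Xs \<subseteq> {wedge x y | x y p q. x \<in> V p \<and> y \<in> V q}"
    then obtain h k u v where uv: "\<forall>a\<in>{1..n}. u a \<in> V (h a) \<and> v a \<in> V (k a)"
      and Xs: "Xs = map (\<lambda>a. wedge (u a) (v a)) [1..<n+1]"
      by (rule homogeneous_wedge_list)
    define d where "d a = h a + k a" for a
    have "\<forall>a\<in>{1..n}. wedge (u a) (v a) \<in> ext2_component V scaleW wedge (d a)"
      unfolding ext2_component_def d_def using uv by (blast intro: W.span_base)
    note deg = l_deg[OF this, folded Xs]
    have "\<forall>a. d a = h a + k a" by (simp add: d_def)
    note hom = G_hom[OF Xs uv this]
    show "G Xs x y + scaleW ((-1) ^ (p * q)) (G Xs y x) = 0"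
      unfolding hom[OF xy(1)] hom[OF xy(2)]
        wedge_skew_int[OF xy(1) deg[OF xy(2)]] wedge_skew_int[OF xy(2) deg[OF xy(1)]]
      by (auto simp: minus_one_powi minus_one_power_iff simp del: of_nat_sum)
  qed fact
  have "graded_skew_bilinear scaleV V scaleW (G Xs)" if Xs: "length Xs = n" for Xs
    unfolding graded_skew_bilinear_def Vector_Spaces.linear_iff
  proof (intro conjI allI impI)
    interpret l: Vector_Spaces.linear scaleV scaleV "l n Xs" by (rule l2) fact
    interpret lE: Vector_Spaces.linear scaleV scaleV "l n (map E Xs)" by (rule l2) (simp add: Xs)
    show "G Xs x (y + y') = G Xs x y + G Xs x y'" for x y y'
      by (simp add: G_def l.add lE.add wedge_simps W.scale_right_distrib)
    show "G Xs x (scaleV r y) = scaleW r (G Xs x y)" for r x y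
      by (simp add: G_def l.scale lE.scale wedge_simps W.scale_right_distrib mult.commute)
    show "G Xs (x + x') y = G Xs x y + G Xs x' y" for x x' y
    proof -
      have "x + x' - e (x + x') = (x - e x) + (x' - e x')" by (simp add: e.add)
      then show ?thesis
        unfolding G_def by (simp only: l.add e.add wedge_simps W.scale_right_distrib) simp
    qed
    show "G Xs (scaleV r x) y = scaleW r (G Xs x y)" for r x y
    proof -
      have "scaleV r x - e (scaleV r x) = scaleV r (x - e x)"
        by (simp add: e.scale V.scale_right_diff_distrib)
      then show ?thesis
        unfolding G_def
        by (simp only: l.scale e.scale wedge_simps W.scale_right_distrib) (simp add: mult.commute)
    qed
    show "G Xs x y = - scaleW ((-1) ^ (p * q)) (G Xs y x)" if "x \<in> V p \<and> y \<in> V q" for p q x y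
      using G_skew[of x p y q Xs] that Xs by (simp add: eq_neg_iff_add_eq_0)
  qed (auto intro: V.vector_space_axioms W.vector_space_axioms)
  then have "\<forall>Xs. \<exists>g. length Xs = n \<longrightarrow>
      Vector_Spaces.linear scaleW scaleW g \<and> (\<forall>x y. g (wedge x y) = G Xs x y)"
    using universal_property by metis
  then obtain K where K: "\<And>Xs. length Xs = n \<Longrightarrow> Vector_Spaces.linear scaleW scaleW (K Xs)"
    and K_wedge: "\<And>Xs x y. length Xs = n \<Longrightarrow> K Xs (wedge x y) = G Xs x y"
    by metis
  interpret WW: vector_space_pair scaleW scaleW by unfold_locales
  have K_multilinear: "multilinear scaleW scaleW n (\<lambda>Xs. K Xs w)" for w
    unfolding multilinear_def
  proof (intro allI impI)
    fix Xs Ys :: "'w list" assume len: "length Xs + length Ys + 1 = n"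
    have eq: "g w = h w" if "Vector_Spaces.linear scaleW scaleW g"
      "Vector_Spaces.linear scaleW scaleW h" "\<And>x y. g (wedge x y) = h (wedge x y)" for g h
      by (rule WW.linear_eq_on[OF that(1,2), of w "range (\<lambda>(x, y). wedge x y)"])
        (use that(3) span_wedge in auto)
    have G: "G (Xs @ (A + B) # Ys) x y = G (Xs @ A # Ys) x y + G (Xs @ B # Ys) x y"
      "G (Xs @ scaleW r A # Ys) x y = scaleW r (G (Xs @ A # Ys) x y)" for A B r x y
      using multilinearD[OF G_multilinear len] unfolding Vector_Spaces.linear_iff by blast+
    have Kl: "Vector_Spaces.linear scaleW scaleW (K (Xs @ A # Ys))" for A
      by (rule K) (use len in simp)
    have Kw: "K (Xs @ A # Ys) (wedge x y) = G (Xs @ A # Ys) x y" for A x y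
      by (rule K_wedge) (use len in simp)
    have "K (Xs @ (A + B) # Ys) w = K (Xs @ A # Ys) w + K (Xs @ B # Ys) w" for A B
      by (rule eq[OF Kl WW.linear_compose_add[OF Kl Kl]]) (simp add: Kw G)
    moreover have "K (Xs @ scaleW r A # Ys) w = scaleW r (K (Xs @ A # Ys) w)" for r A
      by (rule eq[OF Kl WW.linear_compose_scale_right[OF Kl]]) (simp add: Kw G)
    ultimately show "Vector_Spaces.linear scaleW scaleW (\<lambda>A. K (Xs @ A # Ys) w)"
      unfolding Vector_Spaces.linear_iff by (auto intro: W.vector_space_axioms)
  qed
  have "is_induced_map V scaleW wedge l n (\<lambda>Zs. K (butlast Zs) (last Zs))"
    unfolding is_induced_map_def Let_def
  proof (intro conjI allI impI)
    show "multilinear scaleW scaleW (n + 1) (\<lambda>Zs. K (butlast Zs) (last Zs))"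
      unfolding multilinear_def
    proof (intro allI impI)
      fix Xs Ys :: "'w list" assume len: "length Xs + length Ys + 1 = n + 1"
      show "Vector_Spaces.linear scaleW scaleW
          (\<lambda>A. K (butlast (Xs @ A # Ys)) (last (Xs @ A # Ys)))"
      proof (cases Ys rule: rev_cases)
        case Nil
        then show ?thesis using K[of Xs] len by simp
      next
        case (snoc Zs Z)
        then show ?thesis
          using multilinearD[OF K_multilinear, of Xs Zs Z] len
          by (simp add: butlast_append)
      qed
    qed
    fix p q x y assume hom: "\<forall>a\<in>{1..n+1}. x a \<in> V (p a) \<and> y a \<in> V (q a)"
    let ?X = "\<lambda>a. wedge (x a) (y a)"
    have split: "map ?X [1..<n+2] = map ?X [1..<n+1] @ [?X (n+1)]" by simp
    have "K (map ?X [1..<n+1]) (?X (n+1)) = G (map ?X [1..<n+1]) (x (n+1)) (y (n+1))"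
      by (rule K_wedge) (simp del: upt_Suc)
    also have "\<dots> = scaleW ((-1) powi (int (p (n+1)) * (int (\<Sum>a=1..n. p a + q a) + int n - 1)))
            (wedge (x (n+1)) (l n (map ?X [1..<n+1]) (y (n+1))))
          + wedge (l n (map ?X [1..<n+1]) (x (n+1))) (y (n+1))"
      by (rule G_hom) (use hom in auto)
    finally show "K (butlast (map ?X [1..<n+2])) (last (map ?X [1..<n+2]))
        = scaleW ((-1) powi (int (p (n+1)) * (int (\<Sum>a=1..n. p a + q a) + int n - 1)))
            (wedge (x (n+1)) (l n (map ?X [1..<n+1]) (y (n+1))))
          + wedge (l n (map ?X [1..<n+1]) (x (n+1))) (y (n+1))"
      unfolding split by (simp del: upt_Suc)
  qed
  then show ?thesis by blast
qed

end

end

(* Both identities are linear in their last argument, which may therefore be taken to be x \<and> y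
   with x and y homogeneous. Every induced map acts on x \<and> y by a graded Leibniz rule in x and y.
   Expanding all induced maps that have x \<and> y among their arguments, the Lod-infinity expression
   becomes \<plusminus> x \<and> J(y) + J(x) \<and> y, where J is the left-hand side of the 3-Lie-infinity identity,
   plus mixed terms of the form l(A, x) \<and> l(B, y) for all distributions of the remaining arguments
   to two blocks A and B. Each distribution yields two such terms; one of them cancels against
   a term of the distribution in which A and B are exchanged. *)
theory Submission
  imports Defs
begin

section \<open>Signs of unshuffles\<close>

text \<open>The cancellation is a count of parities. Let A and B have lengths i, j and total degrees
  a, b. Exchanging them changes the signature by (-1)^(ij), the Koszul sign by (-1)^(ab), and, with
  the explicit prefactors, the whole sign by (-1)^((a+i-1)(b+j-1)+1). The product is the price of
  moving l(A, -) and l(B, -), of degrees a+i-1 and b+j-1, past each other, and it is matched by the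
  sign of the Leibniz rule; the summand 1 makes the terms cancel. The terms with J(y) can be
  collected because their sign depends only on the degree of x, the total degree and the number of
  the other arguments. Two obstacles shape the preparation. The induced maps are given by a formula
  only on wedges of homogeneous vectors, while their values, which are inserted again, are sums of
  such wedges; so the Leibniz rule has to be extended by multilinearity. And the unary operation
  lowers degrees, so that degree -1 occurs on the way; degrees are therefore integers, with zero
  components in negative degrees. Moreover, the exterior square is given only by a presentation, so
  its grading has to be derived.\<close>

lemma koszul_sign_transpose_degree_1:
  assumes "1 \<le> a" "a < b" "b \<le> m" "\<sigma> permutes {1..m}"
  shows "koszul_sign (\<lambda>_. 1) m (\<sigma> \<circ> transpose a b) = - koszul_sign (\<lambda>_. 1) m \<sigma>"
  using assms
proof (induction "b - a" arbitrary: a \<sigma> rule: less_induct)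
  case less
  let ?t = "transpose a (a + 1)"
  have swap: "koszul_sign (\<lambda>_. 1) m (\<rho> \<circ> ?t) = - koszul_sign (\<lambda>_. 1) m \<rho>"
    if "\<rho> permutes {1..m}" for \<rho>
    using koszul_sign_swap[OF that, of a "\<lambda>_. 1"] less.prems by simp
  show ?case
  proof (cases "b = a + 1")
    case True
    then show ?thesis using swap less.prems by simp
  next
    case False
    \<comment> \<open>Conjugation by the adjacent transposition brings the two positions one step
      closer; the three factors contribute three changes of sign.\<close>
    have "transpose a b = ?t \<circ> transpose (a + 1) b \<circ> ?t"
      using less.prems False by (auto simp: fun_eq_iff transpose_def)
    then have eq: "\<sigma> \<circ> transpose a b = \<sigma> \<circ> ?t \<circ> transpose (a + 1) b \<circ> ?t"
      by (simp add: comp_assoc)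
    have p: "\<sigma> \<circ> ?t permutes {1..m}"
      using less.prems by (intro permutes_compose permutes_swap_id) auto
    have q: "\<sigma> \<circ> ?t \<circ> transpose (a + 1) b permutes {1..m}"
      using less.prems False by (intro permutes_compose[OF _ p] permutes_swap_id) auto
    have "koszul_sign (\<lambda>_. 1) m (\<sigma> \<circ> ?t \<circ> transpose (a + 1) b) = - koszul_sign (\<lambda>_. 1) m (\<sigma> \<circ> ?t)"
      by (rule less.hyps) (use less.prems False p in auto)
    then show ?thesis
      unfolding eq swap[OF q] using swap[OF less.prems(4)] by simp
  qed
qed

text \<open>In degree one every inversion contributes -1, so the Koszul sign counts inversions
  modulo 2. This lets the signature of an exchange of blocks be read off from its Koszul
  sign.\<close>

lemma koszul_sign_degree_1:
  assumes "\<sigma> permutes {1..m}"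
  shows "koszul_sign (\<lambda>_. 1) m \<sigma> = sign \<sigma>"
proof (rule permutes_rev_induct[OF finite_atLeastAtMost assms])
  show "koszul_sign (\<lambda>_. 1) m id = sign id" by (simp add: koszul_sign_id)
  fix a b \<rho>
  assume ab: "a \<in> {1..m}" "b \<in> {1..m}" "a \<noteq> b" and \<rho>: "\<rho> permutes {1..m}"
    and IH: "koszul_sign (\<lambda>_. 1) m \<rho> = sign \<rho>"
  have "koszul_sign (\<lambda>_. 1) m (\<rho> \<circ> transpose a b) = - koszul_sign (\<lambda>_. 1) m \<rho>"
    using koszul_sign_transpose_degree_1[of a b m \<rho>] koszul_sign_transpose_degree_1[of b a m \<rho>]
      ab \<rho> by (cases a b rule: linorder_cases) (auto simp: transpose_commute)
  moreover have "permutation \<rho>" using \<rho> permutation_permutes by blast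
  ultimately show "koszul_sign (\<lambda>_. 1) m (\<rho> \<circ> transpose a b) = sign (\<rho> \<circ> transpose a b)"
    using ab IH by (simp add: sign_compose permutation_swap_id sign_swap_id)
qed

text \<open>Acts on positions and is therefore composed on the right:
  \<open>\<sigma> \<circ> block_swap i j\<close> lists the second block of \<open>\<sigma>\<close>
  before the first. It fixes everything outside \<open>{1..i+j}\<close>, as \<open>permutes\<close>
  demands.\<close>

definition block_swap :: "nat \<Rightarrow> nat \<Rightarrow> nat \<Rightarrow> nat" where
  "block_swap i j a =
    (if 1 \<le> a \<and> a \<le> j then a + i else if j < a \<and> a \<le> i + j then a - j else a)"

lemma block_swap_block_swap: "block_swap i j (block_swap j i a) = a"
  by (auto simp: block_swap_def)

lemma block_swap_permutes: "block_swap i j permutes {1..i+j}"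
proof (rule bij_imp_permutes)
  show "bij_betw (block_swap i j) {1..i+j} {1..i+j}"
    by (rule bij_betw_byWitness[where f' = "block_swap j i"])
      (auto simp: block_swap_block_swap, auto simp: block_swap_def)
qed (auto simp: block_swap_def)

lemma block_swap_unshuffles:
  assumes "\<sigma> \<in> unshuffles i j"
  shows "\<sigma> \<circ> block_swap i j \<in> unshuffles j i"
proof -
  have "\<sigma> \<circ> block_swap i j permutes {1..j+i}"
    using permutes_compose[OF block_swap_permutes] assms
    by (simp add: unshuffles_def add.commute)
  moreover have "strict_mono_on {1..j} (\<sigma> \<circ> block_swap i j)"
    using assms by (auto simp: unshuffles_def strict_mono_on_def block_swap_def)
  moreover have "\<sigma> (r - j) < \<sigma> (s - j)" if "r \<in> {j+1..j+i}" "s \<in> {j+1..j+i}" "r < s" for r s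
  proof -
    have "r - j \<in> {1..i}" "s - j \<in> {1..i}" "r - j < s - j" using that by auto
    then show ?thesis using assms unfolding unshuffles_def strict_mono_on_def by blast
  qed
  then have "strict_mono_on {j+1..j+i} (\<sigma> \<circ> block_swap i j)"
    by (auto simp: strict_mono_on_def block_swap_def)
  ultimately show ?thesis by (simp add: unshuffles_def)
qed

text \<open>An unshuffle increases on each of its two blocks, so an inverted pair has one position
  in each.\<close>

lemma koszul_sign_unshuffle:
  assumes "\<sigma> \<in> unshuffles i j"
  shows "koszul_sign d (i + j) \<sigma> =
    (\<Prod>(a, b) \<in> {(a, b). a \<in> {1..i} \<and> b \<in> {i+1..i+j} \<and> \<sigma> b < \<sigma> a}. (-1) ^ (d (\<sigma> a) * d (\<sigma> b)))"
proof -
  have "\<sigma> a < \<sigma> b" if "1 \<le> a" "a < b" "b \<le> i + j" "b \<le> i \<or> i < a" for a b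
    using assms that by (auto simp: unshuffles_def strict_mono_on_def)
  then have "{(a, b). 1 \<le> a \<and> a < b \<and> b \<le> i + j \<and> \<sigma> b < \<sigma> a}
      = {(a, b). a \<in> {1..i} \<and> b \<in> {i+1..i+j} \<and> \<sigma> b < \<sigma> a}"
    by (auto simp: not_less_iff_gr_or_eq) (meson not_le_imp_less not_less_iff_gr_or_eq Suc_leI)+
  then show ?thesis by (simp add: koszul_sign_def)
qed

text \<open>A pair consisting of an index of the first block and one of the second is inverted by exactly
  one of \<open>\<sigma>\<close> and \<open>\<sigma> \<circ> block_swap i j\<close>.\<close>

lemma koszul_sign_block_swap:
  assumes \<sigma>: "\<sigma> \<in> unshuffles i j"
  shows "koszul_sign d (i + j) (\<sigma> \<circ> block_swap i j) =
    (-1) ^ ((\<Sum>a=1..i. d (\<sigma> a)) * (\<Sum>b=i+1..i+j. d (\<sigma> b))) * koszul_sign d (i + j) \<sigma>"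
proof -
  let ?F = "\<lambda>(a, b). (-1 :: int) ^ (d (\<sigma> a) * d (\<sigma> b))"
  let ?P = "\<lambda>R. {(a, b). a \<in> {1..i} \<and> b \<in> {i+1..i+j} \<and> R (\<sigma> a) (\<sigma> b)}"
  have \<sigma>': "\<sigma> \<circ> block_swap i j \<in> unshuffles j i" by (rule block_swap_unshuffles[OF \<sigma>])
  have inj: "\<sigma> a = \<sigma> b \<longleftrightarrow> a = b" for a b
    using \<sigma> by (auto simp: unshuffles_def dest: permutes_inj injD)
  have swapped: "koszul_sign d (i + j) (\<sigma> \<circ> block_swap i j) = prod ?F (?P (<))"
    unfolding koszul_sign_unshuffle[OF \<sigma>', of d, unfolded add.commute[of j]]
    by (rule prod.reindex_bij_witness[of _ "\<lambda>(a, b). (b - i, a + j)" "\<lambda>(a, b). (b - j, a + i)"])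
      (auto simp: block_swap_def mult.commute split: if_splits)
  have original: "koszul_sign d (i + j) \<sigma> = prod ?F (?P (>))"
    by (rule koszul_sign_unshuffle[OF \<sigma>])
  have "prod ?F (?P (<)) * prod ?F (?P (>)) = prod ?F (?P (<) \<union> ?P (>))"
    by (rule prod.union_disjoint[symmetric])
      (auto intro: finite_subset[of _ "{1..i} \<times> {i+1..i+j}"])
  also have "?P (<) \<union> ?P (>) = {1..i} \<times> {i+1..i+j}"
    using inj by (auto simp: not_less_iff_gr_or_eq)
  also have "prod ?F ({1..i} \<times> {i+1..i+j})
      = (-1) ^ ((\<Sum>a=1..i. d (\<sigma> a)) * (\<Sum>b=i+1..i+j. d (\<sigma> b)))"
    by (simp add: sum_product sum.cartesian_product power_sum case_prod_unfold)
  finally have "prod ?F (?P (<)) * prod ?F (?P (>)) * prod ?F (?P (>))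
      = (-1) ^ ((\<Sum>a=1..i. d (\<sigma> a)) * (\<Sum>b=i+1..i+j. d (\<sigma> b))) * prod ?F (?P (>))"
    by simp
  \<comment> \<open>All factors are signs, so this product is its own inverse and can be moved to
    the other side.\<close>
  moreover have "prod ?F (?P (>)) * prod ?F (?P (>)) = 1"
    by (simp add: prod.distrib[symmetric] case_prod_unfold power_mult_distrib[symmetric])
  ultimately show ?thesis
    unfolding swapped original by (simp only: mult.assoc mult_1_right)
qed

text \<open>In degree one the degree of a block is its length, which turns the exponent of
  \<open>koszul_sign_block_swap\<close> into \<open>i * j\<close>.\<close>

lemma sign_block_swap:
  assumes "\<sigma> \<in> unshuffles i j"
  shows "sign (\<sigma> \<circ> block_swap i j) = (-1) ^ (i * j) * sign \<sigma>"
proof -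
  have "\<sigma> permutes {1..i+j}" "\<sigma> \<circ> block_swap i j permutes {1..i+j}"
    using assms block_swap_unshuffles[OF assms] by (simp_all add: unshuffles_def add.commute)
  then show ?thesis
    using koszul_sign_block_swap[OF assms, of "\<lambda>_. 1"] by (simp add: koszul_sign_degree_1[simplified])
qed

section \<open>Multilinear maps on graded spaces\<close>

text \<open>Each argument has its own spanning set because the arguments have different degrees. A
  subspace \<open>U\<close> serves for degree statements, with \<open>U\<close> a component, as well
  as for identities, with \<open>U = {0}\<close>.\<close>

lemma multilinear_in_subspace:
  assumes f: "multilinear s1 s2 n f" and U: "module.subspace s2 U"
    and f_in: "\<And>ys. list_all2 (\<in>) ys Ss \<Longrightarrow> f ys \<in> U"
    and xs: "list_all2 (\<lambda>x S. x \<in> module.span s1 S) xs Ss" and len: "length xs = n"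
  shows "f xs \<in> U"
proof -
  \<comment> \<open>Entries of \<open>ys\<close> range over spans, entries of \<open>zs\<close> over
    generators. Appending an entry to \<open>ys\<close> extends the claim in that entry from
    generators to their span, since the preimage of \<open>U\<close> under a linear map is a
    subspace.\<close>
  have "f (ys @ zs) \<in> U" if "length ys + length zs = n" and "Ss = Ss1 @ Ss2"
    and "list_all2 (\<lambda>x S. x \<in> module.span s1 S) ys Ss1" and "list_all2 (\<in>) zs Ss2" for ys zs Ss1 Ss2
    using that
  proof (induction ys arbitrary: zs Ss1 Ss2 rule: rev_induct)
    case Nil
    then show ?case using f_in by simp
  next
    case (snoc y ys)
    obtain T Ts where Ss1: "Ss1 = Ts @ [T]" and ys: "list_all2 (\<lambda>x S. x \<in> module.span s1 S) ys Ts"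
      and y: "y \<in> module.span s1 T"
      using snoc.prems(3) by (auto simp: list_all2_append1 list_all2_Cons1)
    have lin: "Vector_Spaces.linear s1 s2 (\<lambda>y. f (ys @ y # zs))"
      by (rule multilinearD[OF f]) (use snoc.prems in simp)
    interpret L: Vector_Spaces.linear s1 s2 "\<lambda>y. f (ys @ y # zs)" by (rule lin)
    have "module.subspace s1 ((\<lambda>y. f (ys @ y # zs)) -` U)"
      by (rule L.subspace_vimage[OF U])
    moreover have "T \<subseteq> (\<lambda>y. f (ys @ y # zs)) -` U"
      using snoc.IH[OF _ _ ys, of "_ # zs" "T # Ss2"] snoc.prems Ss1 by auto
    ultimately have "y \<in> (\<lambda>y. f (ys @ y # zs)) -` U"
      using y L.vs1.span_minimal by blast
    then show ?case by simp
  qed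
  from this[of xs "[]" Ss "[]"] show ?thesis using xs len by simp
qed

context graded_vector_space
begin

text \<open>Sums over one common finite index set replace the supports in \<open>direct_sum\<close>;
  linearity of the homogeneous components then follows from uniqueness.\<close>

lemma homogeneous_sum_unique:
  assumes fg: "\<forall>n. f n \<in> V n" "\<forall>n. g n \<in> V n" and A: "finite A" "{n. f n \<noteq> 0} \<subseteq> A" "{n. g n \<noteq> 0} \<subseteq> A"
    and eq: "sum f A = sum g A"
  shows "f = g"
proof -
  have sup: "(\<Sum>n | h n \<noteq> 0. h n) = sum h A" if "{n. h n \<noteq> 0} \<subseteq> A" for h :: "nat \<Rightarrow> 'v"
    by (rule sum.mono_neutral_left) (use that A(1) in auto)
  have "finite {n. f n \<noteq> 0}" "finite {n. g n \<noteq> 0}" using A finite_subset by blast+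
  then show ?thesis
    using fg eq sup[OF A(2)] sup[OF A(3)] direct_sum[of "sum f A"] by metis
qed

lemma ex_projection:
  "\<exists>e. Vector_Spaces.linear scale scale e \<and> (\<forall>n. \<forall>x\<in>V n. e x = (if n = m then x else 0))"
proof -
  have "\<forall>x. \<exists>f. (\<forall>n. f n \<in> V n) \<and> finite {n. f n \<noteq> 0} \<and> x = (\<Sum>n | f n \<noteq> 0. f n)"
    using direct_sum by blast
  then obtain D where D_in: "\<And>x n. D x n \<in> V n" and fin: "\<And>x. finite {n. D x n \<noteq> 0}"
    and D_sum: "\<And>x. x = (\<Sum>n | D x n \<noteq> 0. D x n)"
    by metis
  have sup: "sum (D x) A = x" if "finite A" "{n. D x n \<noteq> 0} \<subseteq> A" for x A
  proof -
    have "(\<Sum>n | D x n \<noteq> 0. D x n) = sum (D x) A" by (rule sum.mono_neutral_left) (use that in auto)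
    then show ?thesis using D_sum[of x] by simp
  qed
  have D_add: "D (x + y) = (\<lambda>n. D x n + D y n)" for x y
  proof (rule homogeneous_sum_unique)
    let ?A = "{n. D x n \<noteq> 0} \<union> {n. D y n \<noteq> 0} \<union> {n. D (x + y) n \<noteq> 0}"
    show "finite ?A" using fin by simp
    then have "sum (D x) ?A = x" "sum (D y) ?A = y" "sum (D (x + y)) ?A = x + y"
      by (auto intro!: sup)
    then show "sum (D (x + y)) ?A = (\<Sum>n\<in>?A. D x n + D y n)" by (simp only: sum.distrib)
  qed (auto intro: subspace_add[OF subspace_component] D_in)
  have D_scale: "D (scale r x) = (\<lambda>n. scale r (D x n))" for r x
  proof (rule homogeneous_sum_unique)
    let ?A = "{n. D x n \<noteq> 0} \<union> {n. D (scale r x) n \<noteq> 0}"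
    show "finite ?A" using fin by simp
    then have "sum (D x) ?A = x" "sum (D (scale r x)) ?A = scale r x" by (auto intro!: sup)
    then show "sum (D (scale r x)) ?A = (\<Sum>n\<in>?A. scale r (D x n))"
      by (simp only: scale_sum_right[symmetric])
  qed (auto intro: subspace_scale[OF subspace_component] D_in)
  have D_hom: "D x = (\<lambda>m. if m = n then x else 0)" if "x \<in> V n" for x n
  proof (rule homogeneous_sum_unique)
    let ?A = "insert n {n. D x n \<noteq> 0}"
    show "finite ?A" using fin by simp
    then show "sum (D x) ?A = (\<Sum>m\<in>?A. if m = n then x else 0)" by (subst sup) auto
  qed (use that subspace_0[OF subspace_component] in \<open>auto intro: D_in\<close>)
  have "Vector_Spaces.linear scale scale (\<lambda>x. D x m)"
    unfolding Vector_Spaces.linear_iff by (auto simp: D_add D_scale intro: vector_space_axioms)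
  then show ?thesis
    by (intro exI[of _ "\<lambda>x. D x m"]) (auto simp: D_hom)
qed

lemma subspace_int_component: "subspace (int_component V m)"
  by (simp add: int_component_def subspace_component)

end

section \<open>The grading of the exterior square\<close>

context graded_exterior_square
begin

abbreviation "Ext2 \<equiv> ext2_component V scaleW wedge"

lemma wedge_linear:
  "Vector_Spaces.linear scaleV scaleW (wedge x)"
  "Vector_Spaces.linear scaleV scaleW (\<lambda>x. wedge x y)"
  using graded_skew_bilinear_wedge by (auto simp: graded_skew_bilinear_def)

lemma wedge_in_Ext2: "x \<in> V p \<Longrightarrow> y \<in> V q \<Longrightarrow> wedge x y \<in> Ext2 (p + q)"
  unfolding ext2_component_def by (blast intro: W.span_base)

lemma subspace_Ext2: "W.subspace (Ext2 n)"
  unfolding ext2_component_def by simp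

text \<open>A linear map out of the quotient is obtained from the universal property. The projection
  is what yields uniqueness of the decomposition in \<open>graded_vector_space_Ext2\<close>.\<close>

lemma ex_projection_Ext2:
  "\<exists>P. Vector_Spaces.linear scaleW scaleW P \<and> (\<forall>n. \<forall>w\<in>Ext2 n. P w = (if n = m then w else 0))"
proof -
  have "\<forall>k. \<exists>e. Vector_Spaces.linear scaleV scaleV e \<and> (\<forall>n. \<forall>x\<in>V n. e x = (if n = k then x else 0))"
    using V.ex_projection by blast
  then obtain e where e: "\<And>k. Vector_Spaces.linear scaleV scaleV (e k)"
    and e_hom: "\<And>k n x. x \<in> V n \<Longrightarrow> e k x = (if n = k then x else 0)"
    by metis
  \<comment> \<open>The part of degree \<open>m\<close> of \<open>wedge x y\<close>, written with
    the components of both factors so that it is bilinear in all vectors, homogeneous or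
    not.\<close>
  define F where "F x y = (\<Sum>k\<le>m. wedge (e k x) (e (m - k) y))" for x y
  interpret e: Vector_Spaces.linear scaleV scaleV "e k" for k by (rule e)
  interpret VW: vector_space_pair scaleV scaleW by unfold_locales
  have F_hom: "F x y = (if p + q = m then wedge x y else 0)" if "x \<in> V p" "y \<in> V q" for x y p q
  proof -
    have "F x y = (\<Sum>k\<le>m. if k = p then (if q = m - k then wedge x y else 0) else 0)"
      unfolding F_def using that
      by (intro sum.cong) (auto simp: e_hom[of x p] e_hom[of y q] wedge_simps)
    then show ?thesis by auto
  qed
  have "graded_skew_bilinear scaleV V scaleW F"
    unfolding graded_skew_bilinear_def
  proof (intro conjI allI impI)
    show "Vector_Spaces.linear scaleV scaleW (F x)" for x
      unfolding F_def
      by (rule VW.linear_compose_sum)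
        (use Vector_Spaces.linear_compose[OF e wedge_linear(1)] in \<open>auto simp: comp_def\<close>)
    show "Vector_Spaces.linear scaleV scaleW (\<lambda>x. F x y)" for y
      unfolding F_def
      by (rule VW.linear_compose_sum)
        (use Vector_Spaces.linear_compose[OF e wedge_linear(2)] in \<open>auto simp: comp_def\<close>)
    show "F x y = - scaleW ((- 1) ^ (p * q)) (F y x)" if "x \<in> V p \<and> y \<in> V q" for p q x y
      using that wedge_skew[of x p y q] F_hom[of x p y q] F_hom[of y q x p] by (simp add: add.commute)
  qed
  then obtain P where P: "Vector_Spaces.linear scaleW scaleW P" "\<And>x y. P (wedge x y) = F x y"
    using universal_property by blast
  interpret P: Vector_Spaces.linear scaleW scaleW P by (rule P)
  interpret WW: vector_space_pair scaleW scaleW by unfold_locales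
  have "P w = (if n = m then w else 0)" if "w \<in> Ext2 n" for w n
  proof -
    have "Vector_Spaces.linear scaleW scaleW (\<lambda>w. if n = m then w else 0)"
      by (cases "n = m") (auto simp: WW.linear_zero W.linear_id[unfolded id_def])
    then show ?thesis
      by (rule WW.linear_eq_on[OF P(1) _ that[unfolded ext2_component_def]])
        (auto simp: P(2) F_hom)
  qed
  with P(1) show ?thesis by blast
qed

text \<open>Decompositions exist because homogeneous wedges span the whole space; they are unique
  because the projections recover each component from the sum.\<close>

lemma graded_vector_space_Ext2: "graded_vector_space scaleW Ext2"
proof
  show "W.subspace (Ext2 n)" for n by (rule subspace_Ext2)
  have sup: "(\<Sum>n | h n \<noteq> 0. h n) = sum h A" if "finite A" "{n. h n \<noteq> 0} \<subseteq> A"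
    for h :: "nat \<Rightarrow> 'w" and A
    by (rule sum.mono_neutral_left) (use that in auto)
  define Q where "Q = (\<lambda>w f. (\<forall>n. f n \<in> Ext2 n) \<and> finite {n. f n \<noteq> 0} \<and> w = (\<Sum>n | f n \<noteq> 0. f n))"
  have "\<exists>f. Q w f" for w
  proof -
    have "w \<in> W.span {wedge x y | x y p q. x \<in> V p \<and> y \<in> V q}"
      unfolding span_homogeneous_wedge by simp
    then show ?thesis
    proof (induction rule: W.span_induct_alt)
      case base
      show ?case
        by (rule exI[of _ "\<lambda>_. 0"]) (simp add: Q_def W.subspace_0[OF subspace_Ext2])
    next
      case (step c v w)
      then obtain f x y p q where f: "Q w f" and v: "v = wedge x y" "x \<in> V p" "y \<in> V q" by blast
      let ?h = "\<lambda>n. if n = p + q then scaleW c v else 0"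
      let ?A = "insert (p + q) {n. f n \<noteq> 0}"
      have fin: "finite ?A" using f by (simp add: Q_def)
      have A: "{n. ?h n + f n \<noteq> 0} \<subseteq> ?A" by auto
      have "Q (scaleW c v + w) (\<lambda>n. ?h n + f n)"
        unfolding Q_def
      proof (intro conjI allI)
        show "?h n + f n \<in> Ext2 n" for n
          using f v wedge_in_Ext2
          by (auto simp: Q_def intro!: W.subspace_add[OF subspace_Ext2]
              W.subspace_scale[OF subspace_Ext2] W.subspace_0[OF subspace_Ext2])
        show "finite {n. ?h n + f n \<noteq> 0}" by (rule finite_subset[OF A fin])
        have "(\<Sum>n | ?h n + f n \<noteq> 0. ?h n + f n) = sum ?h ?A + sum f ?A"
          unfolding sup[OF fin A] by (rule sum.distrib)
        also have "sum ?h ?A = scaleW c v" using fin by simp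
        also have "sum f ?A = w" using f sup[OF fin, of f, OF subset_insertI] by (simp add: Q_def)
        finally show "scaleW c v + w = (\<Sum>n | ?h n + f n \<noteq> 0. ?h n + f n)" by simp
      qed
      then show ?case by blast
    qed
  qed
  moreover have "f m = g m" if f: "Q w f" and g: "Q w g" for w f g m
  proof -
    obtain P where P: "Vector_Spaces.linear scaleW scaleW P"
      and P_hom: "\<And>n w. w \<in> Ext2 n \<Longrightarrow> P w = (if n = m then w else 0)"
      using ex_projection_Ext2 by blast
    interpret P: Vector_Spaces.linear scaleW scaleW P by (rule P)
    have "P w = h m" if "Q w h" for h
    proof -
      have h: "h n \<in> Ext2 n" "finite {n. h n \<noteq> 0}" for n using that by (auto simp: Q_def)
      have "P w = (\<Sum>n | h n \<noteq> 0. P (h n))" using that by (simp add: Q_def P.sum)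
      also have "\<dots> = (\<Sum>n | h n \<noteq> 0. if n = m then h n else 0)"
        by (intro sum.cong refl P_hom h)
      also have "\<dots> = h m" using h(2) by simp
      finally show ?thesis .
    qed
    then show ?thesis using f g by metis
  qed
  ultimately have "\<exists>!f. Q w f" for w by (metis ext)
  then show "\<exists>!f. (\<forall>n. f n \<in> Ext2 n) \<and> finite {n. f n \<noteq> 0} \<and> w = (\<Sum>n | f n \<noteq> 0. f n)" for w
    by (simp add: Q_def)
qed

end

section \<open>Integer degrees and reduction to wedges of homogeneous vectors\<close>

context graded_exterior_square
begin

text \<open>Indexed by integers: in negative degree the set is empty and its span is
  \<open>{0}\<close>, in agreement with \<open>int_component\<close>.\<close>

definition homogeneous_wedges :: "int \<Rightarrow> 'w set" where
  "homogeneous_wedges e = {wedge x y | x y p q. x \<in> V p \<and> y \<in> V q \<and> int (p + q) = e}"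

lemma int_component_Ext2: "int_component Ext2 e = W.span (homogeneous_wedges e)"
proof (cases "e < 0")
  case True
  then have "homogeneous_wedges e = {}" by (auto simp: homogeneous_wedges_def)
  then show ?thesis using True by (simp add: int_component_def)
next
  case False
  then have "int (p + q) = e \<longleftrightarrow> p + q = nat e" for p q by auto
  then have "homogeneous_wedges e = {wedge x y | x y p q. x \<in> V p \<and> y \<in> V q \<and> p + q = nat e}"
    by (simp only: homogeneous_wedges_def)
  then show ?thesis using False by (simp add: int_component_def ext2_component_def)
qed

lemma homogeneous_wedges_list:
  assumes "list_all2 (\<in>) Xs (map homogeneous_wedges es)" and n: "length Xs = n"
  obtains p q x y where "\<forall>a\<in>{1..n}. x a \<in> V (p a) \<and> y a \<in> V (q a)"
    and "Xs = map (\<lambda>a. wedge (x a) (y a)) [1..<n+1]" and "(\<Sum>a=1..n. int (p a + q a)) = sum_list es"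
proof -
  have len: "length es = n" using list_all2_lengthD[OF assms(1)] n by simp
  have "\<forall>a\<in>{1..n}. \<exists>x y p q. Xs ! (a - 1) = wedge x y \<and> x \<in> V p \<and> y \<in> V q
      \<and> int (p + q) = es ! (a - 1)"
  proof
    fix a assume a: "a \<in> {1..n}"
    then have "Xs ! (a - 1) \<in> homogeneous_wedges (es ! (a - 1))"
      using list_all2_nthD[OF assms(1), of "a - 1"] n len by auto
    then show "\<exists>x y p q. Xs ! (a - 1) = wedge x y \<and> x \<in> V p \<and> y \<in> V q
        \<and> int (p + q) = es ! (a - 1)"
      unfolding homogeneous_wedges_def by blast
  qed
  then have "\<exists>x y p q. \<forall>a\<in>{1..n}. Xs ! (a - 1) = wedge (x a) (y a) \<and> x a \<in> V (p a)
      \<and> y a \<in> V (q a) \<and> int (p a + q a) = es ! (a - 1)"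
    by - ((drule bchoice, erule exE)+, intro exI)
  then obtain x y p q where *: "\<forall>a\<in>{1..n}. Xs ! (a - 1) = wedge (x a) (y a) \<and> x a \<in> V (p a)
      \<and> y a \<in> V (q a) \<and> int (p a + q a) = es ! (a - 1)"
    by blast
  show thesis
  proof
    show "\<forall>a\<in>{1..n}. x a \<in> V (p a) \<and> y a \<in> V (q a)" using * by blast
    show "Xs = map (\<lambda>a. wedge (x a) (y a)) [1..<n+1]"
    proof (rule nth_equalityI)
      fix i assume "i < length Xs"
      then show "Xs ! i = map (\<lambda>a. wedge (x a) (y a)) [1..<n+1] ! i"
        using *[rule_format, of "i + 1"] n by (simp del: upt_Suc)
    qed (use n in \<open>simp del: upt_Suc\<close>)
    have "(\<Sum>a=1..n. int (p a + q a)) = (\<Sum>a=1..n. es ! (a - 1))"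
      by (rule sum.cong) (use * in auto)
    also have "\<dots> = (\<Sum>i<n. es ! i)"
      by (rule sum.reindex_bij_witness[of _ Suc "\<lambda>a. a - 1"]) auto
    also have "\<dots> = sum_list es" using len by (simp add: sum_list_sum_nth atLeast0LessThan)
    finally show "(\<Sum>a=1..n. int (p a + q a)) = sum_list es" .
  qed
qed

text \<open>Only the sum of the degrees is handed on to the wedges, because the signs and target
  degrees below depend on the arguments through that sum alone.\<close>

lemma multilinear_in_subspace_homogeneous:
  assumes f: "multilinear scaleW s n f" and U: "module.subspace s U"
    and f_in: "\<And>p q x y. \<forall>a\<in>{1..n}. x a \<in> V (p a) \<and> y a \<in> V (q a) \<Longrightarrow>
      (\<Sum>a=1..n. int (p a + q a)) = sum_list es \<Longrightarrow>
      f (map (\<lambda>a. wedge (x a) (y a)) [1..<n+1]) \<in> U"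
    and Xs: "list_all2 (\<lambda>X e. X \<in> int_component Ext2 e) Xs es" and len: "length Xs = n"
  shows "f Xs \<in> U"
proof (rule multilinear_in_subspace[OF f U])
  show "list_all2 (\<lambda>x S. x \<in> W.span S) Xs (map homogeneous_wedges es)"
    using Xs by (simp add: list.rel_map int_component_Ext2)
  show "f Ys \<in> U" if "list_all2 (\<in>) Ys (map homogeneous_wedges es)" for Ys
  proof -
    have "length Ys = n" using list_all2_lengthD[OF that] list_all2_lengthD[OF Xs] len by simp
    with that show ?thesis
      by (rule homogeneous_wedges_list) (use f_in in blast)
  qed
qed fact

lemma wedge_in_int_component:
  assumes "x \<in> int_component V p" "y \<in> int_component V q"
  shows "wedge x y \<in> int_component Ext2 (p + q)"
proof (cases "p < 0 \<or> q < 0")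
  case True
  then have "wedge x y = 0" using assms by (auto simp: int_component_def wedge_simps)
  then show ?thesis by (simp add: int_component_Ext2 W.span_zero)
next
  case False
  then show ?thesis
    using assms wedge_in_Ext2[of x "nat p" y "nat q"]
    by (simp add: int_component_def nat_add_distrib)
qed

end

section \<open>Degrees and the Leibniz rule of the induced maps\<close>

locale three_Lie_operations_on = graded_exterior_square +
  fixes l :: "nat \<Rightarrow> 'c list \<Rightarrow> 'b \<Rightarrow> 'b"
  assumes operations: "three_Lie_operations scaleV V scaleW wedge l"
begin

abbreviation "l_ind \<equiv> induced_map V scaleW wedge l"

lemma l_ind: "is_induced_map V scaleW wedge l n (l_ind n)"
  unfolding induced_map_def by (rule someI_ex[OF ex_induced_map[OF operations]])

lemmas operationsD =
  operations[unfolded three_Lie_operations_def, THEN conjunct1]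
  operations[unfolded three_Lie_operations_def, THEN conjunct2, THEN conjunct1]
  operations[unfolded three_Lie_operations_def, THEN conjunct2, THEN conjunct2, THEN conjunct2]

lemma l_multilinear: "multilinear scaleW scaleV n (\<lambda>Xs. l n Xs x)"
  by (rule operationsD(1)[rule_format])

lemma l_linear: "length Xs = n \<Longrightarrow> Vector_Spaces.linear scaleV scaleV (l n Xs)"
  by (rule operationsD(2)[rule_format])

lemma l_degree_Ext2:
  assumes "\<And>a. a \<in> {1..n} \<Longrightarrow> X a \<in> Ext2 (d a)" and "x \<in> V p"
  shows "l n (map X [1..<n+1]) x \<in> int_component V (int (\<Sum>a=1..n. d a) + int p + int n - 1)"
  by (rule operationsD(3)[rule_format]) (use assms in auto)

lemma l_ind_multilinear: "multilinear scaleW scaleW (n + 1) (l_ind n)"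
  using l_ind unfolding is_induced_map_def by blast

lemma l_ind_linear_last:
  assumes "length Xs = n"
  shows "Vector_Spaces.linear scaleW scaleW (\<lambda>w. l_ind n (Xs @ [w]))"
  by (rule multilinearD[OF l_ind_multilinear]) (simp add: assms)

text \<open>Integer degrees are forced by \<open>n = 0\<close>: this operation sends
  \<open>V 0\<close> to degree -1, where every vector is zero, and its values become arguments of
  further operations.\<close>

lemma l_degree:
  assumes Xs: "list_all2 (\<lambda>X e. X \<in> int_component Ext2 e) Xs es" and len: "length Xs = n"
    and x: "x \<in> int_component V p"
  shows "l n Xs x \<in> int_component V (sum_list es + p + int n - 1)"
proof (cases "p < 0")
  case True
  interpret Vector_Spaces.linear scaleV scaleV "l n Xs" by (rule l_linear) fact
  have "l n Xs x = 0" using True x by (simp add: int_component_def zero)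
  then show ?thesis by (simp add: V.subspace_0[OF V.subspace_int_component])
next
  case False
  show ?thesis
  proof (rule multilinear_in_subspace_homogeneous[OF l_multilinear V.subspace_int_component _ Xs len])
    fix h k u v assume uv: "\<forall>a\<in>{1..n}. u a \<in> V (h a) \<and> v a \<in> V (k a)"
      and sum: "(\<Sum>a=1..n. int (h a + k a)) = sum_list es"
    have "x \<in> V (nat p)" using x False by (simp add: int_component_def)
    then have "l n (map (\<lambda>a. wedge (u a) (v a)) [1..<n+1]) x
        \<in> int_component V (int (\<Sum>a=1..n. h a + k a) + int (nat p) + int n - 1)"
      by (rule l_degree_Ext2[rotated]) (use uv wedge_in_Ext2 in blast)
    then show "l n (map (\<lambda>a. wedge (u a) (v a)) [1..<n+1]) x
        \<in> int_component V (sum_list es + p + int n - 1)"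
      using sum False by simp
  qed
qed

text \<open>Goes beyond the defining formula: \<open>Xs\<close> may contain values of other induced
  maps, which are sums of wedges, and \<open>y\<close> is arbitrary. Only \<open>x\<close> stays
  homogeneous, because its degree enters the sign.\<close>

lemma l_ind_wedge:
  assumes Xs: "list_all2 (\<lambda>X e. X \<in> int_component Ext2 e) Xs es" and len: "length Xs = n"
    and x: "x \<in> int_component V p"
  shows "l_ind n (Xs @ [wedge x y]) =
    scaleW ((-1) powi (p * (sum_list es + int n - 1))) (wedge x (l n Xs y)) + wedge (l n Xs x) y"
proof (cases "p < 0")
  case True
  interpret l: Vector_Spaces.linear scaleV scaleV "l n Xs" by (rule l_linear) fact
  interpret i: Vector_Spaces.linear scaleW scaleW "\<lambda>w. l_ind n (Xs @ [w])"
    by (rule l_ind_linear_last) fact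
  have "x = 0" using True x by (simp add: int_component_def)
  then show ?thesis by (simp add: wedge_simps l.zero i.zero)
next
  case False
  define r :: 'a where "r = (-1) powi (p * (sum_list es + int n - 1))"
  have scale_linear: "Vector_Spaces.linear scaleW scaleW (scaleW t)" for t
    by (rule W.linear_scale_self)
  have xV: "x \<in> V (nat p)" using x False by (simp add: int_component_def)
  have hom: "l_ind n (Xs @ [wedge x y]) = scaleW r (wedge x (l n Xs y)) + wedge (l n Xs x) y"
    if y: "y \<in> V q" for y q
  proof -
    \<comment> \<open>The difference of the two sides is multilinear in \<open>Xs\<close>, so
      membership in the zero subspace can be checked on homogeneous wedges.\<close>
    have "l_ind n (Xs @ [wedge x y]) + scaleW (-1) (scaleW r (wedge x (l n Xs y)) + wedge (l n Xs x) y)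
        \<in> {0}"
    proof (rule multilinear_in_subspace_homogeneous[OF _ W.subspace_single_0 _ Xs len])
      have 1: "multilinear scaleW scaleW n (\<lambda>Xs. l_ind n (Xs @ [w]))" for w
        unfolding multilinear_def
      proof (intro allI impI)
        fix Ys Zs :: "'c list" assume "length Ys + length Zs + 1 = n"
        then show "Vector_Spaces.linear scaleW scaleW (\<lambda>X. l_ind n ((Ys @ X # Zs) @ [w]))"
          using multilinearD[OF l_ind_multilinear, of Ys "Zs @ [w]" n] by simp
      qed
      show "multilinear scaleW scaleW n (\<lambda>Xs. l_ind n (Xs @ [wedge x y])
          + scaleW (-1) (scaleW r (wedge x (l n Xs y)) + wedge (l n Xs x) y))"
        by (intro multilinear_add 1
            multilinear_compose[OF _ scale_linear]
            multilinear_compose[OF l_multilinear wedge_linear(1)]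
            multilinear_compose[OF l_multilinear wedge_linear(2)])
      fix h k u v assume uv: "\<forall>a\<in>{1..n}. u a \<in> V (h a) \<and> v a \<in> V (k a)"
        and sum: "(\<Sum>a=1..n. int (h a + k a)) = sum_list es"
      let ?Y = "map (\<lambda>a. wedge (u a) (v a)) [1..<n+1]"
      \<comment> \<open>The defining formula speaks of families indexed by \<open>{1..n+1}\<close>;
        \<open>x\<close> and \<open>y\<close> become their last entries.\<close>
      let ?u = "u(n+1 := x)" and ?v = "v(n+1 := y)" and ?h = "h(n+1 := nat p)" and ?k = "k(n+1 := q)"
      have "\<forall>a\<in>{1..n+1}. ?u a \<in> V (?h a) \<and> ?v a \<in> V (?k a)"
        using uv xV y by auto
      then have "l_ind n (map (\<lambda>a. wedge (?u a) (?v a)) [1..<n+2]) =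
          scaleW ((-1) powi (int (?h (n+1)) * (int (\<Sum>a=1..n. ?h a + ?k a) + int n - 1)))
            (wedge (?u (n+1)) (l n (map (\<lambda>a. wedge (?u a) (?v a)) [1..<n+1]) (?v (n+1))))
          + wedge (l n (map (\<lambda>a. wedge (?u a) (?v a)) [1..<n+1]) (?u (n+1))) (?v (n+1))"
        using l_ind[of n] unfolding is_induced_map_def Let_def by blast
      note formula = this
      have Y: "map (\<lambda>a. wedge (?u a) (?v a)) [1..<n+1] = ?Y" by (rule map_cong) auto
      then have Y': "map (\<lambda>a. wedge (?u a) (?v a)) [1..<n+2] = ?Y @ [wedge x y]" by simp
      have "int (\<Sum>a=1..n. ?h a + ?k a) = sum_list es"
        unfolding sum[symmetric] of_nat_sum by (rule sum.cong) auto
      from formula[unfolded Y Y' this] have "l_ind n (?Y @ [wedge x y])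
          = scaleW r (wedge x (l n ?Y y)) + wedge (l n ?Y x) y"
        using False by (simp add: r_def del: upt_Suc)
      then show "l_ind n (?Y @ [wedge x y])
          + scaleW (-1) (scaleW r (wedge x (l n ?Y y)) + wedge (l n ?Y x) y) \<in> {0}"
        by (simp del: upt_Suc)
    qed
    then show ?thesis
      unfolding singleton_iff W.scale_minus_left W.scale_one add_eq_0_iff2 minus_minus .
  qed
  interpret l: Vector_Spaces.linear scaleV scaleV "l n Xs" by (rule l_linear) fact
  interpret VW: vector_space_pair scaleV scaleW by unfold_locales
  have i_lin: "Vector_Spaces.linear scaleV scaleW (\<lambda>y. l_ind n (Xs @ [wedge x y]))"
    using Vector_Spaces.linear_compose[OF wedge_linear(1)[of x] l_ind_linear_last[OF len]]
    by (simp add: comp_def)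
  have o_lin: "Vector_Spaces.linear scaleV scaleW
      (\<lambda>y. scaleW r (wedge x (l n Xs y)) + wedge (l n Xs x) y)"
    using Vector_Spaces.linear_compose[OF l_linear[OF len] wedge_linear(1)[of x]]
    by (intro VW.linear_compose_add VW.linear_compose_scale_right wedge_linear(1))
      (simp add: comp_def)
  have "y \<in> V.span (\<Union>n. V n)" by (simp add: V.span_homogeneous)
  then show ?thesis
    unfolding r_def[symmetric]
    by (rule VW.linear_eq_on[OF i_lin o_lin]) (use hom in auto)
qed

text \<open>On a list of wedges the Leibniz rule gives two wedges; in each of them the degree of one
  factor is changed by the same amount.\<close>

lemma l_ind_degree:
  assumes Xs: "list_all2 (\<lambda>X e. X \<in> int_component Ext2 e) Xs es" and len: "length Xs = n + 1"
  shows "l_ind n Xs \<in> int_component Ext2 (sum_list es + int n - 1)"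
proof -
  have "W.subspace (int_component Ext2 e)" for e by (simp add: int_component_Ext2)
  then show ?thesis
  proof (rule multilinear_in_subspace_homogeneous[OF l_ind_multilinear _ _ Xs len])
    fix h k u v assume uv: "\<forall>a\<in>{1..n+1}. u a \<in> V (h a) \<and> v a \<in> V (k a)"
      and sum: "(\<Sum>a=1..n+1. int (h a + k a)) = sum_list es"
    let ?Y = "map (\<lambda>a. wedge (u a) (v a)) [1..<n+1]"
    let ?e = "map (\<lambda>a. int (h a + k a)) [1..<n+1]"
    let ?x = "u (n+1)" and ?y = "v (n+1)" and ?p = "int (h (n+1))" and ?q = "int (k (n+1))"
    have Y: "list_all2 (\<lambda>X e. X \<in> int_component Ext2 e) ?Y ?e"
      unfolding list.rel_map
    proof (rule list.rel_refl_strong)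
      fix a assume "a \<in> set [1..<n+1]"
      then have "a \<in> {1..n+1}" by auto
      then have "wedge (u a) (v a) \<in> Ext2 (h a + k a)" using uv wedge_in_Ext2 by blast
      then show "wedge (u a) (v a) \<in> int_component Ext2 (int (h a + k a))"
        by (simp add: int_component_def del: of_nat_add)
    qed
    have x: "?x \<in> int_component V ?p" and y: "?y \<in> int_component V ?q"
      using uv by (auto simp: int_component_def)
    have s: "sum_list ?e = (\<Sum>a=1..n. int (h a + k a))"
      by (simp add: interv_sum_list_conv_sum_set_nat atLeastLessThanSuc_atLeastAtMost del: upt_Suc)
    have e: "sum_list es = sum_list ?e + ?p + ?q" using sum unfolding s by simp
    have "wedge ?x (l n ?Y ?y) \<in> int_component Ext2 (sum_list es + int n - 1)"
      "wedge (l n ?Y ?x) ?y \<in> int_component Ext2 (sum_list es + int n - 1)"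
      using wedge_in_int_component[OF x l_degree[OF Y _ y, of n]]
        wedge_in_int_component[OF l_degree[OF Y _ x, of n] y] unfolding e
      by (simp_all add: algebra_simps del: upt_Suc)
    then have "l_ind n (?Y @ [wedge ?x ?y]) \<in> int_component Ext2 (sum_list es + int n - 1)"
      using l_ind_wedge[OF Y _ x, of n ?y]
      by (auto simp: int_component_Ext2 simp del: upt_Suc intro!: W.span_add W.span_scale)
    then show "l_ind n (map (\<lambda>a. wedge (u a) (v a)) [1..<n+1+1])
        \<in> int_component Ext2 (sum_list es + int n - 1)" by simp
  qed
qed

end

section \<open>The Leibniz identity\<close>

lemma finite_unshuffles: "finite (unshuffles i j)"
  by (rule finite_subset[of _ "{\<sigma>. \<sigma> permutes {1..i+j}}"])
    (auto simp: unshuffles_def intro: finite_permutations)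

lemma sum_pairs_cong:
  assumes "\<And>i j. i + j = m \<Longrightarrow> f i j = g i j"
  shows "(\<Sum>(i, j) \<in> {(i, j). i + j = (m :: nat)}. f i j) = (\<Sum>(i, j) \<in> {(i, j). i + j = m}. g i j)"
  by (rule sum.cong) (use assms in auto)

text \<open>A Lod-infinity operation is indexed by its number of arguments, the corresponding
  induced map by one less.\<close>

lemma sum_pairs_Suc:
  "(\<Sum>(i, j) \<in> {(i, j). 1 \<le> i \<and> 1 \<le> j \<and> i + j = m + 1 + 1}. f i j)
    = (\<Sum>(i, j) \<in> {(i, j). i + j = (m :: nat)}. f (Suc i) (Suc j))"
  by (rule sum.reindex_bij_witness[of _ "map_prod Suc Suc" "map_prod (\<lambda>i. i - 1) (\<lambda>i. i - 1)"])
    auto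

lemma finite_sum_pairs: "finite {(i, j). i + j = (m :: nat)}"
  by (rule finite_subset[of _ "{..m} \<times> {..m}"]) auto

section \<open>Both identities in the same shape, with the last argument split off\<close>

context three_Lie_operations_on
begin

text \<open>With \<open>k = m + 1\<close> this is also the sign in the second sum of the 3-Lie-infinity identity, so that
  this sum and the terms of the Lod-infinity identity with \<open>k = n\<close> have the same shape.\<close>

definition insertion_sign :: "(nat \<Rightarrow> nat) \<Rightarrow> nat \<Rightarrow> nat \<Rightarrow> (nat \<Rightarrow> nat) \<Rightarrow> int" where
  "insertion_sign d j k \<sigma> = (-1) ^ ((k - j) * j) * (-1) ^ ((j + 1) * (\<Sum>a=1..k-j-1. d (\<sigma> a)))
    * sign \<sigma> * koszul_sign d (k - 1) \<sigma>"

definition inner_insertion :: "nat \<Rightarrow> (nat \<Rightarrow> 'c) \<Rightarrow> nat \<Rightarrow> nat \<Rightarrow> (nat \<Rightarrow> nat) \<Rightarrow> 'c list" where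
  "inner_insertion m X j k \<sigma> = map (\<lambda>a. X (\<sigma> a)) [1..<k-j]
    @ [l_ind j (map (\<lambda>a. X (\<sigma> a)) [k-j..<k] @ [X k])] @ map X [k+1..<m+1]"

text \<open>For \<open>\<sigma> \<in> unshuffles i j\<close> with \<open>i + j = m\<close>, this
  list and \<open>second_block m X i \<sigma>\<close> are the blocks A and B.\<close>

definition first_block :: "(nat \<Rightarrow> 'c) \<Rightarrow> nat \<Rightarrow> (nat \<Rightarrow> nat) \<Rightarrow> 'c list" where
  "first_block X i \<sigma> = map (\<lambda>a. X (\<sigma> a)) [1..<i+1]"

definition second_block :: "nat \<Rightarrow> (nat \<Rightarrow> 'c) \<Rightarrow> nat \<Rightarrow> (nat \<Rightarrow> nat) \<Rightarrow> 'c list" where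
  "second_block m X i \<sigma> = map (\<lambda>a. X (\<sigma> a)) [i+1..<m+1]"

definition jacobiator :: "nat \<Rightarrow> (nat \<Rightarrow> nat) \<Rightarrow> (nat \<Rightarrow> 'c) \<Rightarrow> 'b \<Rightarrow> 'b" where
  "jacobiator m d X z =
    (\<Sum>(i, j) \<in> {(i, j). i + j = m}. \<Sum>k = j+1..m. \<Sum>\<sigma> \<in> unshuffles (k - j - 1) j.
      scaleV (of_int (insertion_sign d j k \<sigma>)) (l i (inner_insertion m X j k \<sigma>) z))
    + (\<Sum>(i, j) \<in> {(i, j). i + j = m}. \<Sum>\<sigma> \<in> unshuffles i j.
      scaleV (of_int (insertion_sign d j (m + 1) \<sigma>))
        (l i (first_block X i \<sigma>) (l j (second_block m X i \<sigma>) z)))"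

text \<open>The Lod-infinity expression in \<open>m + 1\<close> arguments, the last of which is
  \<open>w\<close>. The first sum has \<open>w\<close> in the outer map, the second, coming from
  \<open>k = m + 1\<close>, in the inner one. This is the shape of \<open>jacobiator\<close>, with
  \<open>l\<close> replaced by \<open>l_ind\<close>.\<close>

definition leibnizator :: "nat \<Rightarrow> (nat \<Rightarrow> nat) \<Rightarrow> (nat \<Rightarrow> 'c) \<Rightarrow> 'c \<Rightarrow> 'c" where
  "leibnizator m d X w =
    (\<Sum>(i, j) \<in> {(i, j). i + j = m}. \<Sum>k = j+1..m. \<Sum>\<sigma> \<in> unshuffles (k - j - 1) j.
      scaleW (of_int (insertion_sign d j k \<sigma>)) (l_ind i (inner_insertion m X j k \<sigma> @ [w])))
    + (\<Sum>(i, j) \<in> {(i, j). i + j = m}. \<Sum>\<sigma> \<in> unshuffles i j.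
      scaleW (of_int (insertion_sign d j (m + 1) \<sigma>))
        (l_ind i (first_block X i \<sigma> @ [l_ind j (second_block m X i \<sigma> @ [w])])))"

lemma length_inner_insertion:
  assumes "i + j = m" "k \<in> {j+1..m}"
  shows "length (inner_insertion m X j k \<sigma>) = i"
  using assms by (auto simp: inner_insertion_def simp del: upt_Suc)

lemma length_blocks [simp]:
  "length (first_block X i \<sigma>) = i" "length (second_block m X i \<sigma>) = m - i"
  by (simp_all add: first_block_def second_block_def del: upt_Suc)

lemma leibnizator_linear: "Vector_Spaces.linear scaleW scaleW (leibnizator m d X)"
proof -
  interpret WW: vector_space_pair scaleW scaleW by unfold_locales
  have 2: "Vector_Spaces.linear scaleW scaleW
      (\<lambda>w. l_ind i (first_block X i \<sigma> @ [l_ind j (second_block m X i \<sigma> @ [w])]))"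
    if "i + j = m" for i j \<sigma>
    using Vector_Spaces.linear_compose[OF l_ind_linear_last[of "second_block m X i \<sigma>" j]
        l_ind_linear_last[of "first_block X i \<sigma>" i]] that by (auto simp: comp_def)
  show ?thesis
    unfolding leibnizator_def case_prod_unfold
    by (intro WW.linear_compose_add WW.linear_compose_sum ballI WW.linear_compose_scale_right
        l_ind_linear_last length_inner_insertion 2) auto
qed

section \<open>Expansion of the Lod-infinity expression on a wedge\<close>

context
  fixes m :: nat and d :: "nat \<Rightarrow> nat" and X :: "nat \<Rightarrow> 'c"
  assumes X: "\<And>a. a \<in> {1..m} \<Longrightarrow> X a \<in> Ext2 (d a)"
begin

lemma homogeneous_list:
  assumes "\<And>a. a \<in> set as \<Longrightarrow> f a \<in> {1..m}"
  shows "list_all2 (\<lambda>X e. X \<in> int_component Ext2 e)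
    (map (\<lambda>a. X (f a)) as) (map (\<lambda>a. int (d (f a))) as)"
  unfolding list.rel_map
  by (rule list.rel_refl_strong) (use X[OF assms] in \<open>auto simp: int_component_def\<close>)

lemma sum_list_degrees: "(\<Sum>a\<leftarrow>[r..<s]. int (f a)) = int (\<Sum>a\<in>{r..<s}. f a)"
  by (simp add: interv_sum_list_conv_sum_set_nat)

text \<open>The sign is the same for all insertions: the inserted value adds \<open>j - 1\<close> to
  the total degree and the outer map adds \<open>i - 1\<close>, which makes \<open>m - 2\<close> in
  any case, and the 2 is irrelevant for the parity.\<close>

lemma l_ind_inner_insertion:
  assumes ij: "i + j = m" and k: "k \<in> {j+1..m}" and \<sigma>: "\<sigma> permutes {1..k-1}" and x: "x \<in> V p"
  shows "l_ind i (inner_insertion m X j k \<sigma> @ [wedge x y]) =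
    scaleW ((-1) powi (int p * (int (\<Sum>a=1..m. d a) + int m)))
      (wedge x (l i (inner_insertion m X j k \<sigma>) y))
    + wedge (l i (inner_insertion m X j k \<sigma>) x) y"
proof -
  let ?A = "map (\<lambda>a. int (d (\<sigma> a))) [1..<k-j]" and ?B = "map (\<lambda>a. int (d (\<sigma> a))) [k-j..<k]"
    and ?C = "map (\<lambda>a. int (d a)) [k+1..<m+1]"
  let ?Z = "sum_list (?B @ [int (d k)]) + int j - 1"
  have \<sigma>_in: "\<sigma> a \<in> {1..m}" if "1 \<le> a" "a < k" for a
  proof -
    have "a \<in> {1..k-1}" using that by auto
    then have "\<sigma> a \<in> {1..k-1}" using permutes_in_image[OF \<sigma>] by blast
    then show ?thesis using k by auto
  qed
  have A: "list_all2 (\<lambda>X e. X \<in> int_component Ext2 e) (map (\<lambda>a. X (\<sigma> a)) [1..<k-j]) ?A"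
    by (rule homogeneous_list) (rule \<sigma>_in, auto)
  have B: "list_all2 (\<lambda>X e. X \<in> int_component Ext2 e) (map (\<lambda>a. X (\<sigma> a)) [k-j..<k]) ?B"
    by (rule homogeneous_list) (rule \<sigma>_in, use k in auto)
  have C: "list_all2 (\<lambda>X e. X \<in> int_component Ext2 e) (map X [k+1..<m+1]) ?C"
    by (rule homogeneous_list) auto
  have Xk: "X k \<in> int_component Ext2 (int (d k))" using X[of k] k by (auto simp: int_component_def)
  have "list_all2 (\<lambda>X e. X \<in> int_component Ext2 e)
      (map (\<lambda>a. X (\<sigma> a)) [k-j..<k] @ [X k]) (?B @ [int (d k)])"
    by (intro list_all2_appendI B) (simp add: Xk)
  then have Z: "l_ind j (map (\<lambda>a. X (\<sigma> a)) [k-j..<k] @ [X k]) \<in> int_component Ext2 ?Z"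
    by (rule l_ind_degree) (use k in auto)
  have hom: "list_all2 (\<lambda>X e. X \<in> int_component Ext2 e)
      (inner_insertion m X j k \<sigma>) (?A @ [?Z] @ ?C)"
    unfolding inner_insertion_def by (intro list_all2_appendI A C) (use Z in simp)
  have "(\<Sum>a\<in>{1..<k-j}. d (\<sigma> a)) + (\<Sum>a\<in>{k-j..<k}. d (\<sigma> a)) = (\<Sum>a\<in>{1..<k}. d (\<sigma> a))"
    by (rule sum.atLeastLessThan_concat) (use k in auto)
  also have "\<dots> = (\<Sum>a\<in>{1..<k}. d a)"
  proof -
    have "{1..<k} = {1..k-1}" using k by auto
    then show ?thesis using sum.permute[OF \<sigma>, of d] by (simp add: comp_def)
  qed
  finally have AB: "(\<Sum>a\<in>{1..<k-j}. d (\<sigma> a)) + (\<Sum>a\<in>{k-j..<k}. d (\<sigma> a)) = (\<Sum>a\<in>{1..<k}. d a)" .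
  have "(\<Sum>a=1..m. d a) = (\<Sum>a\<in>{1..<m+1}. d a)"
    by (rule sum.cong) auto
  also have "\<dots> = (\<Sum>a\<in>{1..<k}. d a) + (\<Sum>a\<in>{k..<m+1}. d a)"
    by (rule sum.atLeastLessThan_concat[symmetric]) (use k in auto)
  also have "(\<Sum>a\<in>{k..<m+1}. d a) = d k + (\<Sum>a\<in>{k+1..<m+1}. d a)"
    using sum.atLeast_Suc_lessThan[of k "m+1" d] k by auto
  finally have D: "(\<Sum>a=1..m. d a) = (\<Sum>a\<in>{1..<k-j}. d (\<sigma> a)) + (\<Sum>a\<in>{k-j..<k}. d (\<sigma> a))
      + d k + (\<Sum>a\<in>{k+1..<m+1}. d a)"
    unfolding AB by simp
  have "sum_list (?A @ [?Z] @ ?C) + int i - 1 = int (\<Sum>a=1..m. d a) + int m - 2"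
    unfolding D using ij by (simp add: sum_list_degrees del: upt_Suc)
  moreover have "(-1 :: 'a) powi (int p * (int (\<Sum>a=1..m. d a) + int m - 2))
      = (-1) powi (int p * (int (\<Sum>a=1..m. d a) + int m))"
    by (simp add: minus_one_powi)
  moreover have "x \<in> int_component V (int p)" using x by (simp add: int_component_def)
  ultimately show ?thesis
    using l_ind_wedge[OF hom length_inner_insertion[OF ij k]] by metis
qed

definition degree_A :: "nat \<Rightarrow> (nat \<Rightarrow> nat) \<Rightarrow> int" where
  "degree_A i \<sigma> = int (\<Sum>a=1..i. d (\<sigma> a))"

definition degree_B :: "nat \<Rightarrow> (nat \<Rightarrow> nat) \<Rightarrow> int" where
  "degree_B i \<sigma> = int (\<Sum>a=i+1..m. d (\<sigma> a))"

lemma degree_A_B: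
  assumes "i + j = m" "\<sigma> \<in> unshuffles i j"
  shows "degree_A i \<sigma> + degree_B i \<sigma> = int (\<Sum>a=1..m. d a)"
proof -
  have "(\<Sum>a=1..m. d a) = (\<Sum>a=1..m. d (\<sigma> a))"
    using assms sum.permute[of \<sigma> "{1..m}" d] by (simp add: unshuffles_def comp_def)
  also have "\<dots> = (\<Sum>a=1..i. d (\<sigma> a)) + (\<Sum>a=i+1..m. d (\<sigma> a))"
    using assms(1) sum.ub_add_nat[of 1 i "\<lambda>a. d (\<sigma> a)" j] by simp
  finally show ?thesis by (simp add: degree_A_def degree_B_def)
qed

text \<open>The inner Leibniz rule applies \<open>l j\<close> to \<open>y\<close>, which produces
  the power of -1 with factor \<open>p\<close>; the outer rule then applies \<open>l i\<close> to
  \<open>x\<close>, without a further sign.\<close>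

definition cross_term :: "'b \<Rightarrow> nat \<Rightarrow> 'b \<Rightarrow> nat \<Rightarrow> nat \<Rightarrow> (nat \<Rightarrow> nat) \<Rightarrow> 'c" where
  "cross_term x p y i j \<sigma> =
    scaleW (of_int (insertion_sign d j (m + 1) \<sigma>) * (-1) powi (int p * (degree_B i \<sigma> + int j - 1)))
      (wedge (l i (first_block X i \<sigma>) x) (l j (second_block m X i \<sigma>) y))"

text \<open>Of the two mixed terms arising from \<open>l_ind i (A, l_ind j (B, x \<and> y))\<close>, the second is the
  negative of the first one for the opposite distribution of the arguments.\<close>

lemma cross_term_block_swap:
  assumes ij: "i + j = m" and \<sigma>: "\<sigma> \<in> unshuffles i j"
  shows "cross_term x p y j i (\<sigma> \<circ> block_swap i j) =
    - scaleW (of_int (insertion_sign d j (m + 1) \<sigma>)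
        * (-1) powi ((int p + degree_B i \<sigma> + int j - 1) * (degree_A i \<sigma> + int i - 1)))
      (wedge (l j (second_block m X i \<sigma>) x) (l i (first_block X i \<sigma>) y))"
proof -
  let ?\<rho> = "\<sigma> \<circ> block_swap i j"
  have A: "first_block X j ?\<rho> = second_block m X i \<sigma>"
    by (rule nth_equalityI)
      (use ij in \<open>auto simp: first_block_def second_block_def block_swap_def add.commute simp del: upt_Suc\<close>)
  have B: "second_block m X j ?\<rho> = first_block X i \<sigma>"
    by (rule nth_equalityI)
      (use ij in \<open>auto simp: first_block_def second_block_def block_swap_def simp del: upt_Suc\<close>)
  have sA: "(\<Sum>a=1..j. d (?\<rho> a)) = (\<Sum>a=i+1..m. d (\<sigma> a))"
    by (rule sum.reindex_bij_witness[of _ "\<lambda>a. a - i" "\<lambda>a. a + i"])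
      (use ij in \<open>auto simp: block_swap_def\<close>)
  have sB: "(\<Sum>a=j+1..m. d (?\<rho> a)) = (\<Sum>a=1..i. d (\<sigma> a))"
    by (rule sum.reindex_bij_witness[of _ "\<lambda>a. a + j" "\<lambda>a. a - j"])
      (use ij in \<open>auto simp: block_swap_def\<close>)
  define a b where "a = (\<Sum>a=1..i. d (\<sigma> a))" and "b = (\<Sum>a=i+1..m. d (\<sigma> a))"
  define e where "e = sign \<sigma> * koszul_sign d m \<sigma>"
  have deg: "degree_A i \<sigma> = int a" "degree_B i \<sigma> = int b" "degree_B j ?\<rho> = int a"
    by (simp_all only: degree_A_def degree_B_def a_def b_def sB)
  have "insertion_sign d j (m + 1) \<sigma> = (-1) ^ ((i + 1) * j) * (-1) ^ ((j + 1) * a) * e"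
    using ij by (auto simp: insertion_sign_def a_def e_def)
  moreover have "insertion_sign d i (m + 1) ?\<rho>
      = (-1) ^ ((j + 1) * i) * (-1) ^ ((i + 1) * b) * ((-1) ^ (i * j) * (-1) ^ (a * b) * e)"
    using ij sA sign_block_swap[OF \<sigma>] koszul_sign_block_swap[OF \<sigma>, of d]
    by (auto simp: insertion_sign_def a_def b_def e_def)
  \<comment> \<open>The terms with \<open>p\<close> agree on both sides. Modulo 2, the exponents of
    the two insertion signs differ by the expansion of \<open>(b + j - 1) * (a + i - 1)\<close>
    without its constant term 1, hence the minus sign.\<close>
  ultimately have "of_int (insertion_sign d i (m + 1) ?\<rho>) * (-1) powi (int p * (int a + int i - 1))
      = - ((of_int (insertion_sign d j (m + 1) \<sigma>) :: 'a)
        * (-1) powi ((int p + int b + int j - 1) * (int a + int i - 1)))"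
    by (auto simp: minus_one_power_iff minus_one_powi)
  then show ?thesis
    unfolding cross_term_def A B deg by simp
qed

text \<open>The subtracted terms, summed over all distributions, are the first ones reindexed by the
  exchange of blocks. Whole sums are compared, so \<open>m = 0\<close>, where the exchange fixes the
  only distribution, is no exception.\<close>

lemma sum_cross_terms:
  "(\<Sum>(i, j) \<in> {(i, j). i + j = m}. \<Sum>\<sigma> \<in> unshuffles i j.
      cross_term x p y i j \<sigma> - cross_term x p y j i (\<sigma> \<circ> block_swap i j)) = 0"
proof -
  let ?S = "SIGMA ij:{(i, j). i + j = m}. unshuffles (fst ij) (snd ij)"
  let ?swap = "\<lambda>(ij, \<sigma>). (prod.swap ij, \<sigma> \<circ> block_swap (fst ij) (snd ij))"
  have sum: "(\<Sum>(i, j) \<in> {(i, j). i + j = m}. \<Sum>\<sigma> \<in> unshuffles i j. g i j \<sigma>)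
      = (\<Sum>(ij, \<sigma>) \<in> ?S. g (fst ij) (snd ij) \<sigma>)" for g :: "nat \<Rightarrow> nat \<Rightarrow> (nat \<Rightarrow> nat) \<Rightarrow> 'c"
    by (simp add: sum.Sigma finite_sum_pairs[unfolded case_prod_unfold] finite_unshuffles case_prod_unfold)
  have "(\<Sum>(i, j) \<in> {(i, j). i + j = m}. \<Sum>\<sigma> \<in> unshuffles i j. cross_term x p y j i (\<sigma> \<circ> block_swap i j))
      = (\<Sum>(i, j) \<in> {(i, j). i + j = m}. \<Sum>\<sigma> \<in> unshuffles i j. cross_term x p y i j \<sigma>)"
    unfolding sum
    by (rule sum.reindex_bij_witness[of _ ?swap ?swap])
      (auto simp: comp_def block_swap_block_swap dest: block_swap_unshuffles)
  then show ?thesis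
    by (simp add: sum_subtractf case_prod_unfold)
qed

lemma l_ind_l_ind_wedge:
  assumes ij: "i + j = m" and \<sigma>: "\<sigma> \<in> unshuffles i j" and x: "x \<in> V p"
  shows "scaleW (of_int (insertion_sign d j (m + 1) \<sigma>))
      (l_ind i (first_block X i \<sigma> @ [l_ind j (second_block m X i \<sigma> @ [wedge x y])])) =
    scaleW ((-1) powi (int p * (int (\<Sum>a=1..m. d a) + int m)))
      (wedge x (scaleV (of_int (insertion_sign d j (m + 1) \<sigma>))
        (l i (first_block X i \<sigma>) (l j (second_block m X i \<sigma>) y))))
    + wedge (scaleV (of_int (insertion_sign d j (m + 1) \<sigma>))
        (l i (first_block X i \<sigma>) (l j (second_block m X i \<sigma>) x))) y
    + (cross_term x p y i j \<sigma> - cross_term x p y j i (\<sigma> \<circ> block_swap i j))"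
proof -
  let ?A = "first_block X i \<sigma>" and ?B = "second_block m X i \<sigma>"
  let ?a = "map (\<lambda>a. int (d (\<sigma> a))) [1..<i+1]" and ?b = "map (\<lambda>a. int (d (\<sigma> a))) [i+1..<m+1]"
  let ?c = "of_int (insertion_sign d j (m + 1) \<sigma>) :: 'a"
  have \<sigma>_in: "\<sigma> a \<in> {1..m}" if "a \<in> {1..m}" for a
    using \<sigma> ij that permutes_in_image[of \<sigma> "{1..m}" a] by (simp add: unshuffles_def)
  have A: "list_all2 (\<lambda>X e. X \<in> int_component Ext2 e) ?A ?a"
    unfolding first_block_def by (rule homogeneous_list) (rule \<sigma>_in, use ij in auto)
  have B: "list_all2 (\<lambda>X e. X \<in> int_component Ext2 e) ?B ?b"
    unfolding second_block_def by (rule homogeneous_list) (rule \<sigma>_in, use ij in auto)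
  have a: "sum_list ?a = degree_A i \<sigma>" and b: "sum_list ?b = degree_B i \<sigma>"
    unfolding sum_list_degrees degree_A_def degree_B_def
    by (simp_all add: atLeastLessThanSuc_atLeastAtMost)
  have len: "length ?A = i" "length ?B = j" using ij by auto
  have xI: "x \<in> int_component V (int p)" using x by (simp add: int_component_def)
  define r s :: int where "r = int p * (degree_B i \<sigma> + int j - 1)"
    and "s = int p * (degree_A i \<sigma> + int i - 1)"
  interpret lA: Vector_Spaces.linear scaleW scaleW "\<lambda>w. l_ind i (?A @ [w])"
    by (rule l_ind_linear_last) fact
  have inner: "l_ind j (?B @ [wedge x y]) = scaleW ((-1) powi r) (wedge x (l j ?B y)) + wedge (l j ?B x) y"
    using l_ind_wedge[OF B len(2) xI, of y] unfolding b r_def .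
  have o1: "l_ind i (?A @ [wedge x (l j ?B y)]) =
      scaleW ((-1) powi s) (wedge x (l i ?A (l j ?B y))) + wedge (l i ?A x) (l j ?B y)"
    using l_ind_wedge[OF A len(1) xI, of "l j ?B y"] unfolding a s_def .
  \<comment> \<open>The left factor is now \<open>l j ?B x\<close>, so its degree
    \<open>p + degree_B i \<sigma> + j - 1\<close> takes the place of \<open>p\<close> in the
    sign.\<close>
  have o2: "l_ind i (?A @ [wedge (l j ?B x) y]) =
      scaleW ((-1) powi ((int p + degree_B i \<sigma> + int j - 1) * (degree_A i \<sigma> + int i - 1)))
        (wedge (l j ?B x) (l i ?A y)) + wedge (l i ?A (l j ?B x)) y"
    using l_ind_wedge[OF A len(1) l_degree[OF B len(2) xI], of y] unfolding a b
    by (simp add: add.commute add.left_commute)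
  \<comment> \<open>The two exponents add up to \<open>p\<close> times the total degree plus
    \<open>m - 2\<close>: the same sign as in \<open>l_ind_inner_insertion\<close>.\<close>
  have "(-1 :: 'a) powi r * (-1) powi s = (-1) powi (int p * (degree_A i \<sigma> + degree_B i \<sigma> + int m))"
    unfolding r_def s_def ij[symmetric] by (auto simp: minus_one_powi)
  then have e: "(-1 :: 'a) powi r * (-1) powi s = (-1) powi (int p * (int (\<Sum>a=1..m. d a) + int m))"
    unfolding degree_A_B[OF ij \<sigma>] .
  show ?thesis
    unfolding inner lA.add lA.scale o1 o2 cross_term_block_swap[OF ij \<sigma>] e[symmetric]
    unfolding cross_term_def r_def[symmetric]
    by (simp add: wedge_simps W.scale_right_distrib mult_ac)
qed

text \<open>Insertions and iterated maps carry one common sign before \<open>wedge x\<close>, so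
  these terms add up to a wedge with a single \<open>jacobiator\<close>; the mixed terms vanish by
  \<open>sum_cross_terms\<close>.\<close>

lemma leibnizator_wedge:
  assumes x: "x \<in> V p"
  shows "leibnizator m d X (wedge x y) =
    scaleW ((-1) powi (int p * (int (\<Sum>a=1..m. d a) + int m))) (wedge x (jacobiator m d X y))
    + wedge (jacobiator m d X x) y"
proof -
  define r :: 'a where "r = (-1) powi (int p * (int (\<Sum>a=1..m. d a) + int m))"
  interpret L: Vector_Spaces.linear scaleV scaleW "wedge x" by (rule wedge_linear)
  interpret R: Vector_Spaces.linear scaleV scaleW "\<lambda>x. wedge x y" by (rule wedge_linear)
  have 1: "(\<Sum>(i, j) \<in> {(i, j). i + j = m}. \<Sum>k = j+1..m. \<Sum>\<sigma> \<in> unshuffles (k - j - 1) j.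
      scaleW (of_int (insertion_sign d j k \<sigma>)) (l_ind i (inner_insertion m X j k \<sigma> @ [wedge x y])))
    = (\<Sum>(i, j) \<in> {(i, j). i + j = m}. \<Sum>k = j+1..m. \<Sum>\<sigma> \<in> unshuffles (k - j - 1) j.
      scaleW r (wedge x (scaleV (of_int (insertion_sign d j k \<sigma>)) (l i (inner_insertion m X j k \<sigma>) y)))
      + wedge (scaleV (of_int (insertion_sign d j k \<sigma>)) (l i (inner_insertion m X j k \<sigma>) x)) y)"
  proof (intro sum_pairs_cong sum.cong refl)
    fix i j k \<sigma> assume ij: "i + j = m" and k: "k \<in> {j+1..m}" and \<sigma>: "\<sigma> \<in> unshuffles (k - j - 1) j"
    then have "k - j - 1 + j = k - 1" by auto
    then have "\<sigma> permutes {1..k-1}" using \<sigma> by (simp add: unshuffles_def)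
    note eq = l_ind_inner_insertion[OF ij k this x, of y, folded r_def]
    show "scaleW (of_int (insertion_sign d j k \<sigma>))
        (l_ind i (inner_insertion m X j k \<sigma> @ [wedge x y])) =
      scaleW r (wedge x (scaleV (of_int (insertion_sign d j k \<sigma>)) (l i (inner_insertion m X j k \<sigma>) y)))
      + wedge (scaleV (of_int (insertion_sign d j k \<sigma>)) (l i (inner_insertion m X j k \<sigma>) x)) y"
      unfolding eq by (simp add: wedge_simps W.scale_right_distrib mult.commute)
  qed
  have 2: "(\<Sum>(i, j) \<in> {(i, j). i + j = m}. \<Sum>\<sigma> \<in> unshuffles i j.
      scaleW (of_int (insertion_sign d j (m + 1) \<sigma>))
        (l_ind i (first_block X i \<sigma> @ [l_ind j (second_block m X i \<sigma> @ [wedge x y])])))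
    = (\<Sum>(i, j) \<in> {(i, j). i + j = m}. \<Sum>\<sigma> \<in> unshuffles i j.
      scaleW r (wedge x (scaleV (of_int (insertion_sign d j (m + 1) \<sigma>))
        (l i (first_block X i \<sigma>) (l j (second_block m X i \<sigma>) y))))
      + wedge (scaleV (of_int (insertion_sign d j (m + 1) \<sigma>))
        (l i (first_block X i \<sigma>) (l j (second_block m X i \<sigma>) x))) y
      + (cross_term x p y i j \<sigma> - cross_term x p y j i (\<sigma> \<circ> block_swap i j)))"
    unfolding r_def by (intro sum_pairs_cong sum.cong refl l_ind_l_ind_wedge x)
  show ?thesis
    unfolding leibnizator_def jacobiator_def 1 2 r_def[symmetric]
    using sum_cross_terms[of x p y]
    by (simp add: L.add R.add L.sum R.sum sum.distrib W.scale_right_distrib W.scale_sum_right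
        case_prod_unfold)
qed

end

end

section \<open>Vanishing of both expressions and comparison with the definitions\<close>

context three_Lie_operations_on
begin

lemma jacobiator_eq_0:
  assumes "three_Lie_infty scaleV V scaleW wedge l"
    and X: "\<And>a. a \<in> {1..m} \<Longrightarrow> X a \<in> Ext2 (d a)" and z: "z \<in> V p"
  shows "jacobiator m d X z = 0"
proof -
  note axiom = assms(1)[unfolded three_Lie_infty_def, THEN conjunct2, THEN conjunct2,
      THEN spec[of _ "m + 1"], THEN mp, THEN spec[of _ d], THEN spec[of _ X], THEN spec[of _ p],
      THEN spec[of _ z], THEN mp]
  have "jacobiator m d X z =
      (\<Sum>(i, j) \<in> {(i, j). i + j = m + 1 - 1}. \<Sum>k = j+1..m+1-1. \<Sum>\<sigma> \<in> unshuffles (k - j - 1) j.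
        scaleV (of_int ((-1) ^ ((k - j) * j) * (-1) ^ ((j + 1) * (\<Sum>a=1..k-j-1. d (\<sigma> a)))
                  * sign \<sigma> * koszul_sign d (k - 1) \<sigma>))
          (l i (map (\<lambda>a. X (\<sigma> a)) [1..<k-j]
                @ [l_ind j (map (\<lambda>a. X (\<sigma> a)) [k-j..<k] @ [X k])]
                @ map X [k+1..<m+1]) z))
      + (\<Sum>(i, j) \<in> {(i, j). i + j = m + 1 - 1}. \<Sum>\<sigma> \<in> unshuffles i j.
        scaleV (of_int ((-1) ^ ((i + 1) * j) * (-1) ^ ((j + 1) * (\<Sum>a=1..i. d (\<sigma> a)))
                  * sign \<sigma> * koszul_sign d (m + 1 - 1) \<sigma>))
          (l i (map (\<lambda>a. X (\<sigma> a)) [1..<i+1]) (l j (map (\<lambda>a. X (\<sigma> a)) [i+1..<m+1]) z)))"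
    unfolding jacobiator_def insertion_sign_def inner_insertion_def first_block_def second_block_def
      add_diff_cancel_right'
    \<comment> \<open>In the second sum, \<open>(k - j) * j\<close> at \<open>k = m + 1\<close>
      becomes \<open>(i + 1) * j\<close>.\<close>
    by (intro arg_cong2[of _ _ _ _ "(+)"] refl sum_pairs_cong sum.cong) auto
  also have "\<dots> = 0"
    by (rule axiom) (use X z in auto)
  finally show ?thesis .
qed

lemma leibnizator_eq_0:
  assumes "three_Lie_infty scaleV V scaleW wedge l"
    and X: "\<And>a. a \<in> {1..m} \<Longrightarrow> X a \<in> Ext2 (d a)"
  shows "leibnizator m d X w = 0"
proof -
  interpret L: Vector_Spaces.linear scaleW scaleW "leibnizator m d X" by (rule leibnizator_linear)
  have "leibnizator m d X (wedge x y) = 0" if "x \<in> V p" "y \<in> V q" for x y p q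
    using leibnizator_wedge[OF X that(1), where y = y] that jacobiator_eq_0[OF assms]
    by (simp add: wedge_simps)
  then have "\<And>u. u \<in> {wedge x y | x y p q. x \<in> V p \<and> y \<in> V q} \<Longrightarrow> leibnizator m d X u = 0"
    by auto
  moreover have "w \<in> W.span {wedge x y | x y p q. x \<in> V p \<and> y \<in> V q}"
    unfolding span_homogeneous_wedge by simp
  ultimately show ?thesis by (rule L.eq_0_on_span)
qed

lemma Lod_sum_eq_leibnizator:
  "(\<Sum>(i, j) \<in> {(i, j). 1 \<le> i \<and> 1 \<le> j \<and> i + j = m + 1 + 1}. \<Sum>k = j..m+1.
      \<Sum>\<sigma> \<in> unshuffles (k - j) (j - 1).
        scaleW (of_int ((-1) ^ ((k + 1 - j) * (j - 1)) * (-1) ^ (j * (\<Sum>a=1..k-j. d (\<sigma> a)))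
                 * sign \<sigma> * koszul_sign d (k - 1) \<sigma>))
          (l_ind (i - 1) (map (\<lambda>a. X (\<sigma> a)) [1..<k-j+1]
                @ [l_ind (j - 1) (map (\<lambda>a. X (\<sigma> a)) [k+1-j..<k] @ [X k])]
                @ map X [k+1..<m+1+1])))
    = leibnizator m d X (X (m + 1))"
  (is "(\<Sum>(i, j) \<in> _. ?S i j) = _")
proof -
  define T where "T i j k = (\<Sum>\<sigma> \<in> unshuffles (k - j - 1) j.
      scaleW (of_int (insertion_sign d j k \<sigma>))
        (l_ind i (map (\<lambda>a. X (\<sigma> a)) [1..<k-j]
          @ [l_ind j (map (\<lambda>a. X (\<sigma> a)) [k-j..<k] @ [X k])] @ map X [k+1..<m+1+1])))" for i j k
  have "(\<Sum>(i, j) \<in> {(i, j). 1 \<le> i \<and> 1 \<le> j \<and> i + j = m + 1 + 1}. ?S i j)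
      = (\<Sum>(i, j) \<in> {(i, j). i + j = m}. ?S (Suc i) (Suc j))"
    by (rule sum_pairs_Suc)
  also have "\<dots> = (\<Sum>(i, j) \<in> {(i, j). i + j = m}. (\<Sum>k = j+1..m. T i j k) + T i j (m + 1))"
  proof (rule sum_pairs_cong)
    fix i j assume "i + j = m"
    \<comment> \<open>After the shift, \<open>k + 1 - Suc j\<close> is \<open>k - j\<close> and
      \<open>Suc j - 1\<close> is \<open>j\<close>, so the Lod-infinity sign becomes
      \<open>insertion_sign\<close>.\<close>
    have "?S (Suc i) (Suc j) = (\<Sum>k = j+1..m+1. T i j k)"
      unfolding T_def insertion_sign_def
      by (intro sum.cong refl) (auto simp: Suc_diff_Suc simp del: upt_Suc)
    \<comment> \<open>Only for the top value of \<open>k\<close> does \<open>X (m + 1)\<close> sit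
      in the inner map; otherwise it ends the outer list.\<close>
    also have "\<dots> = (\<Sum>k = j+1..m. T i j k) + T i j (m + 1)"
      using \<open>i + j = m\<close> by simp
    finally show "?S (Suc i) (Suc j) = (\<Sum>k = j+1..m. T i j k) + T i j (m + 1)" .
  qed
  also have "\<dots> = (\<Sum>(i, j) \<in> {(i, j). i + j = m}. \<Sum>k = j+1..m. T i j k)
      + (\<Sum>(i, j) \<in> {(i, j). i + j = m}. T i j (m + 1))"
    by (simp add: sum.distrib case_prod_unfold)
  also have "\<dots> = leibnizator m d X (X (m + 1))"
    unfolding leibnizator_def T_def inner_insertion_def first_block_def second_block_def
    by (intro arg_cong2[of _ _ _ _ "(+)"] refl sum_pairs_cong sum.cong) auto
  finally show ?thesis .
qed

end

theorem theorem3p2: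
  fixes scaleV :: "'k::field_char_0 \<Rightarrow> 'v::ab_group_add \<Rightarrow> 'v"
    and V :: "nat \<Rightarrow> 'v set"
    and scaleW :: "'k \<Rightarrow> 'w::ab_group_add \<Rightarrow> 'w"
    and wedge :: "'v \<Rightarrow> 'v \<Rightarrow> 'w"
    and l :: "nat \<Rightarrow> 'w list \<Rightarrow> 'v \<Rightarrow> 'v"
  assumes "graded_exterior_square scaleV V scaleW wedge"
    and "three_Lie_infty scaleV V scaleW wedge l"
  shows "Lod_infty scaleW (ext2_component V scaleW wedge)
           (\<lambda>n. induced_map V scaleW wedge l (n - 1))"
proof -
  interpret graded_exterior_square scaleV V scaleW wedge by (rule assms(1))
  interpret three_Lie_operations_on scaleV V scaleW wedge l
    by unfold_locales (rule assms(2)[unfolded three_Lie_infty_def, THEN conjunct2, THEN conjunct1])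
  show ?thesis
    unfolding Lod_infty_def
  proof (intro conjI allI impI)
    show "graded_vector_space scaleW Ext2" by (rule graded_vector_space_Ext2)
    show "multilinear scaleW scaleW k (l_ind (k - 1))" if "1 \<le> k" for k
      using l_ind_multilinear[of "k - 1"] that by simp
    show "l_ind (k - 1) (map x [1..<k+1]) \<in> int_component Ext2 (int (\<Sum>a=1..k. d a) + int k - 2)"
      if "1 \<le> k" "\<forall>a\<in>{1..k}. x a \<in> Ext2 (d a)" for k d x
    proof -
      have hom: "list_all2 (\<lambda>X e. X \<in> int_component Ext2 e)
          (map x [1..<k+1]) (map (\<lambda>a. int (d a)) [1..<k+1])"
        by (rule homogeneous_list[where m = k and f = "\<lambda>a. a"]) (use that(2) in auto)
      \<comment> \<open>The induced map with index \<open>k - 1\<close> has degree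
        \<open>(k - 1) - 1\<close>, as required of an operation with \<open>k\<close>
        arguments.\<close>
      have "sum_list (map (\<lambda>a. int (d a)) [1..<k+1]) + int (k - 1) - 1
          = int (\<Sum>a=1..k. d a) + int k - 2"
        using that(1) by (simp add: interv_sum_list_conv_sum_set_nat
            atLeastLessThanSuc_atLeastAtMost of_nat_diff del: upt_Suc)
      then show ?thesis
        using l_ind_degree[OF hom, of "k - 1"] that(1) by (simp del: upt_Suc)
    qed
    fix n d x assume n: "1 \<le> (n :: nat)" and x: "\<forall>a\<in>{1..n}. x a \<in> Ext2 (d a)"
    then obtain m where m: "n = m + 1" by (metis le_add_diff_inverse2)
    show "(\<Sum>(i, j) \<in> {(i, j). 1 \<le> i \<and> 1 \<le> j \<and> i + j = n + 1}. \<Sum>k = j..n. \<Sum>\<sigma> \<in> unshuffles (k - j) (j - 1).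
        scaleW (of_int ((-1) ^ ((k + 1 - j) * (j - 1)) * (-1) ^ (j * (\<Sum>a=1..k-j. d (\<sigma> a)))
                 * sign \<sigma> * koszul_sign d (k - 1) \<sigma>))
          (l_ind (i - 1) (map (\<lambda>a. x (\<sigma> a)) [1..<k-j+1]
                @ [l_ind (j - 1) (map (\<lambda>a. x (\<sigma> a)) [k+1-j..<k] @ [x k])]
                @ map x [k+1..<n+1]))) = 0"
      unfolding m Lod_sum_eq_leibnizator
      by (rule leibnizator_eq_0[OF assms(2)]) (use x m in auto)
  qed
qed

end
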